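(* Let $\alpha \in \mathbb{R}$. Let $f, g \in A^\infty(\mathbb{B}_n)$ and assume that $|g| \le |f|$ on $\mathbb{B}_n$. Then there exists a natural number $N$ such that $$[g^N] \subseteq [f],$$ where $[h]$ denotes the closed (invariant) subspace of $D_\alpha(\mathbb{B}_n)$ generated by $h$.
   Context: $\mathbb{B}_n$ is the open Euclidean unit ball of $\mathbb{C}^n$. $A^\infty(\mathbb{B}_n) := \mathcal{O}(\mathbb{B}_n) \cap \mathcal{C}^\infty(\overline{\mathbb{B}}_n)$ is the algebra of holomorphic functions on $\mathbb{B}_n$ that are smooth up to the boundary. For $\alpha \in \mathbb{R}$, the Dirichlet-type space $D_\alpha(\mathbb{B}_n)$ consists of the holomorphic functions $f(z)=\sum_k a_k z^k$ on $\mathbb{B}_n$ ($k$ ranging over multi-indices) with $$\|f\|_\alpha^2 := \sum_{|k|=0}^\infty (n+|k|)^\alpha \frac{(n-1)!\,k!}{(n-1+|k|)!}\,|a_k|^2 < \infty,$$ where $|k|=k_1+\cdots+k_n$, $k!=k_1!\cdots k_n!$, $z^k=z_1^{k_1}\cdots z_n^{k_n}$. One has $A^\infty(\mathbb{B}_n) \subset D_\alpha(\mathbb{B}_n)$. For $h \in D_\alpha(\mathbb{B}_n)$, $[h]$ is the closure in $D_\alpha(\mathbb{B}_n)$ of $\operatorname{span}\{ph : p \in \mathbb{C}[z_1,\ldots,z_n]\}$. *)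

theory Defs
  imports "HOL-Analysis.Analysis" "HOL-Library.Function_Algebras"
begin

text \<open>
  The dimension is \<open>n = CARD('n) \<ge> 1\<close>, and the norm of \<^typ>\<open>complex ^ 'n\<close> is the Euclidean one.
  A function on the unit ball is represented by a total function on \<^typ>\<open>complex ^ 'n\<close>. Membership
  in \<open>A_infinity\<close>, \<open>dirichlet_space\<close> and \<open>invariant_subspace\<close> and the value of \<open>dirichlet_norm\<close>
  depend only on the restriction to the open ball.
\<close>

abbreviation unit_ball :: "(complex ^ 'n::finite) set"
  where "unit_ball \<equiv> ball 0 1"

definition holomorphic_several_on ::
    "(complex ^ 'n::finite \<Rightarrow> complex) \<Rightarrow> (complex ^ 'n) set \<Rightarrow> bool"
  where "holomorphic_several_on f S \<longleftrightarrow>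
    (\<forall>z\<in>S. \<exists>L. (f has_derivative L) (at z) \<and> (\<forall>c v. L (c *s v) = c * L v))"

fun iterated_partial :: "'a list \<Rightarrow> ('a::euclidean_space \<Rightarrow> 'b::real_normed_vector) \<Rightarrow> 'a \<Rightarrow> 'b"
  where
    "iterated_partial [] f = f"
  | "iterated_partial (b # bs) f = (\<lambda>x. frechet_derivative (iterated_partial bs f) (at x) b)"

text \<open>
  The space \<open>C\<^sup>\<infinity>(closure S)\<close> for open \<open>S\<close>: all real partial derivatives of all orders exist on \<open>S\<close>
  and extend continuously to the closure. On \<^typ>\<open>complex ^ 'n\<close>, \<^const>\<open>Basis\<close> consists of the
  \<open>2 n\<close> real coordinate directions.
\<close>

definition smooth_up_to_boundary ::
    "('a::euclidean_space \<Rightarrow> 'b::real_normed_vector) \<Rightarrow> 'a set \<Rightarrow> bool"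
  where "smooth_up_to_boundary f S \<longleftrightarrow>
    (\<forall>bs. set bs \<subseteq> Basis \<longrightarrow>
      iterated_partial bs f differentiable_on S \<and>
      (\<exists>G. continuous_on (closure S) G \<and> (\<forall>x\<in>S. G x = iterated_partial bs f x)))"

definition A_infinity :: "(complex ^ 'n::finite \<Rightarrow> complex) set"
  where "A_infinity = {f. holomorphic_several_on f unit_ball \<and> smooth_up_to_boundary f unit_ball}"

definition mi_abs :: "('n::finite \<Rightarrow> nat) \<Rightarrow> nat"
  where "mi_abs k = (\<Sum>i\<in>UNIV. k i)"

definition mi_fact :: "('n::finite \<Rightarrow> nat) \<Rightarrow> real"
  where "mi_fact k = (\<Prod>i\<in>UNIV. fact (k i))"

definition mi_power :: "complex ^ 'n::finite \<Rightarrow> ('n \<Rightarrow> nat) \<Rightarrow> complex"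
  where "mi_power z k = (\<Prod>i\<in>UNIV. (z $ i) ^ k i)"

text \<open>
  The coefficients \<open>a\<^sub>k\<close> of \<open>f(z) = \<Sum>\<^sub>k a\<^sub>k z\<^sup>k\<close>; they exist and are unique for every function that is
  holomorphic on the unit ball.
\<close>

definition power_series_coeff :: "(complex ^ 'n::finite \<Rightarrow> complex) \<Rightarrow> ('n \<Rightarrow> nat) \<Rightarrow> complex"
  where "power_series_coeff f =
    (THE a. \<forall>z\<in>unit_ball. ((\<lambda>k. a k * mi_power z k) has_sum f z) UNIV)"

definition dirichlet_term ::
    "real \<Rightarrow> (complex ^ 'n::finite \<Rightarrow> complex) \<Rightarrow> ('n \<Rightarrow> nat) \<Rightarrow> real"
  where "dirichlet_term \<alpha> f k =
    real (CARD('n) + mi_abs k) powr \<alpha> *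
    (fact (CARD('n) - 1) * mi_fact k / fact (CARD('n) - 1 + mi_abs k)) *
    (cmod (power_series_coeff f k))\<^sup>2"

definition dirichlet_space :: "real \<Rightarrow> (complex ^ 'n::finite \<Rightarrow> complex) set"
  where "dirichlet_space \<alpha> =
    {f. holomorphic_several_on f unit_ball \<and> dirichlet_term \<alpha> f summable_on UNIV}"

definition dirichlet_norm :: "real \<Rightarrow> (complex ^ 'n::finite \<Rightarrow> complex) \<Rightarrow> real"
  where "dirichlet_norm \<alpha> f = sqrt (\<Sum>\<^sub>\<infinity>k. dirichlet_term \<alpha> f k)"

definition dirichlet_closure ::
    "real \<Rightarrow> (complex ^ 'n::finite \<Rightarrow> complex) set \<Rightarrow> (complex ^ 'n \<Rightarrow> complex) set"
  where "dirichlet_closure \<alpha> S =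
    {u \<in> dirichlet_space \<alpha>.
      \<forall>\<epsilon>>0. \<exists>s \<in> S \<inter> dirichlet_space \<alpha>. dirichlet_norm \<alpha> (\<lambda>z. u z - s z) < \<epsilon>}"

definition complex_polynomials :: "(complex ^ 'n::finite \<Rightarrow> complex) set"
  where "complex_polynomials = {p. \<exists>K c. finite K \<and> p = (\<lambda>z. \<Sum>k\<in>K. c k * mi_power z k)}"

text \<open>
  The complex linear span is the library's \<^const>\<open>module.span\<close> for pointwise scalar multiplication.
\<close>

definition invariant_subspace ::
    "real \<Rightarrow> (complex ^ 'n::finite \<Rightarrow> complex) \<Rightarrow> (complex ^ 'n \<Rightarrow> complex) set"
  where "invariant_subspace \<alpha> h =
    dirichlet_closure \<alpha>
      (module.span (\<lambda>c u z. c * u z) {(\<lambda>z. p z * h z) | p. p \<in> complex_polynomials})"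

end

theory Submission
  imports Defs "HOL-Complex_Analysis.Complex_Analysis"
begin

text \<open>
  The quotient \<open>Q = p g ^ N / f\<close>, with \<open>p\<close> a polynomial, is holomorphic on the ball and has bounded
  derivatives up to any prescribed order \<open>m\<close>, once \<open>N\<close> is large: the \<open>m\<close>-th derivative is a combination
  of terms \<open>g ^ a \<psi> / f ^ b\<close> with \<open>a - b\<close> at least \<open>N - m - 1\<close> and bounded \<open>\<psi>\<close>, and \<open>\<bar>g\<bar> \<le> \<bar>f\<bar>\<close>
  (lemma \<open>bounded_derivs_power_quotient\<close>). The same domination removes the zeros of \<open>f\<close>, where \<open>Q\<close> is
  \<open>0\<close> and \<open>O(\<bar>f\<bar>\<^sup>2)\<close>. Hence the homogeneous parts of \<open>Q\<close> decay like \<open>j ^ (- m)\<close>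
  (\<open>hom_part_decay\<close>), and so do those of \<open>f\<close>. If \<open>q\<close> is a Taylor polynomial of \<open>Q\<close>, the homogeneous
  parts of \<open>f (Q - q)\<close> are convolutions of such sequences, hence small with some decay left. Finally,
  decay of the homogeneous parts controls the Dirichlet norm (\<open>dirichlet_norm_bound_of_decay\<close>), so
  \<open>q f\<close> tends to \<open>Q f = p g ^ N\<close> in the space (\<open>polynomial_multiple_approximation\<close>). Thus all
  polynomial multiples of \<open>g ^ N\<close> lie in the closure of those of \<open>f\<close>, and \<open>N\<close> depends only on \<open>\<alpha>\<close>
  and the dimension.

  Only derivatives along slices \<open>w \<mapsto> f (w z)\<close> through the origin are needed, so one-variable
  complex analysis suffices, except for the power series expansion on the ball. The latter is obtained
  by showing that the Taylor coefficients of the slices, as functions of \<open>z\<close>, are entire on each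
  complex line with polynomial growth, hence polynomials by Liouville's theorem and interpolation
  (\<open>separately_polynomial\<close>), whose coefficients are bounded by averages over roots of unity
  (\<open>torus_coeff_bound\<close>). The norm estimate compares the weights \<open>k! / \<bar>k\<bar>!\<close> with the largest value of
  \<open>\<bar>z ^ k\<bar>\<^sup>2\<close> on the unit sphere, up to polynomial factors (\<open>multinomial_weight_bound\<close>).
\<close>

text \<open>Below, \<open>$\<close> only denotes the components of a vector.\<close>

no_notation fps_nth (infixl \<open>$\<close> 75)

section \<open>Holomorphic functions of several variables and their slices\<close>

lemma norm_vector_smult: "norm (c *s z) = cmod c * norm (z :: complex ^ 'n::finite)"
  by (simp add: norm_vec_def L2_set_def norm_mult power_mult_distrib real_sqrt_mult flip: sum_distrib_left)

lemma holomorphic_several_onD: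
  assumes "holomorphic_several_on f S" "z \<in> S"
  obtains L where "(f has_derivative L) (at z)" "\<And>c v. L (c *s v) = c * L v"
  using assms unfolding holomorphic_several_on_def by blast

lemma holomorphic_several_on_const: "holomorphic_several_on (\<lambda>_. c) S"
  unfolding holomorphic_several_on_def by (auto intro!: exI[of _ "\<lambda>_. 0"])

lemma holomorphic_several_on_component: "holomorphic_several_on (\<lambda>z. z $ i) S"
  unfolding holomorphic_several_on_def
  by (auto intro!: exI[of _ "\<lambda>z. z $ i"] bounded_linear_imp_has_derivative bounded_linear_vec_nth)

lemma holomorphic_several_on_add:
  assumes "holomorphic_several_on f S" "holomorphic_several_on g S"
  shows "holomorphic_several_on (\<lambda>z. f z + g z) S"
  unfolding holomorphic_several_on_def
proof
  fix z assume z: "z \<in> S"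
  from holomorphic_several_onD[OF assms(1) z] obtain L where
    L: "(f has_derivative L) (at z)" "\<And>c v. L (c *s v) = c * L v" by blast
  from holomorphic_several_onD[OF assms(2) z] obtain M where
    M: "(g has_derivative M) (at z)" "\<And>c v. M (c *s v) = c * M v" by blast
  show "\<exists>L. ((\<lambda>z. f z + g z) has_derivative L) (at z) \<and> (\<forall>c v. L (c *s v) = c * L v)"
    by (rule exI[of _ "\<lambda>v. L v + M v"]) (auto intro!: derivative_intros L M simp: L M algebra_simps)
qed

lemma holomorphic_several_on_mult:
  assumes "holomorphic_several_on f S" "holomorphic_several_on g S"
  shows "holomorphic_several_on (\<lambda>z. f z * g z) S"
  unfolding holomorphic_several_on_def
proof
  fix z assume z: "z \<in> S"
  from holomorphic_several_onD[OF assms(1) z] obtain L where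
    L: "(f has_derivative L) (at z)" "\<And>c v. L (c *s v) = c * L v" by blast
  from holomorphic_several_onD[OF assms(2) z] obtain M where
    M: "(g has_derivative M) (at z)" "\<And>c v. M (c *s v) = c * M v" by blast
  show "\<exists>L. ((\<lambda>z. f z * g z) has_derivative L) (at z) \<and> (\<forall>c v. L (c *s v) = c * L v)"
    by (rule exI[of _ "\<lambda>v. f z * M v + L v * g z"])
       (auto intro!: derivative_eq_intros L(1) M(1) simp: L M algebra_simps)
qed

lemma holomorphic_several_on_diff:
  assumes "holomorphic_several_on f S" "holomorphic_several_on g S"
  shows "holomorphic_several_on (\<lambda>z. f z - g z) S"
  using holomorphic_several_on_add[OF assms(1) holomorphic_several_on_mult[OF 
      holomorphic_several_on_const[of "-1"] assms(2)]]
  by (simp add: algebra_simps)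

lemma holomorphic_several_on_power:
  "holomorphic_several_on f S \<Longrightarrow> holomorphic_several_on (\<lambda>z. f z ^ N) S"
  by (induction N) (auto intro: holomorphic_several_on_const holomorphic_several_on_mult)

lemma holomorphic_several_on_sum:
  "(\<And>i. i \<in> I \<Longrightarrow> holomorphic_several_on (f i) S) \<Longrightarrow> holomorphic_several_on (\<lambda>z. \<Sum>i\<in>I. f i z) S"
  by (induction I rule: infinite_finite_induct)
     (auto intro: holomorphic_several_on_const holomorphic_several_on_add)

lemma holomorphic_several_on_prod:
  "(\<And>i. i \<in> I \<Longrightarrow> holomorphic_several_on (f i) S) \<Longrightarrow> holomorphic_several_on (\<lambda>z. \<Prod>i\<in>I. f i z) S"
  by (induction I rule: infinite_finite_induct)
     (auto intro: holomorphic_several_on_const holomorphic_several_on_mult)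

lemma holomorphic_several_on_polynomial:
  "p \<in> complex_polynomials \<Longrightarrow> holomorphic_several_on p S"
  unfolding complex_polynomials_def mi_power_def
  by (auto intro!: holomorphic_several_on_sum holomorphic_several_on_mult holomorphic_several_on_const
      holomorphic_several_on_prod holomorphic_several_on_power holomorphic_several_on_component)

lemma holomorphic_several_on_imp_continuous_on:
  "holomorphic_several_on f S \<Longrightarrow> continuous_on S f"
  unfolding holomorphic_several_on_def
  by (meson continuous_at_imp_continuous_on has_derivative_continuous)

lemma holomorphic_several_on_has_field_derivative:
  fixes u v :: "complex ^ 'n::finite"
  assumes "(f has_derivative L) (at (u + t *s v))" "\<And>c v. L (c *s v) = c * L v"
  shows "((\<lambda>t. f (u + t *s v)) has_field_derivative L v) (at t)"
proof -
  have "((\<lambda>t. u + t *s v) has_derivative (\<lambda>s. s *s v)) (at t)"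
  proof -
    have "bounded_linear (\<lambda>s::complex. s *s v)"
      by (rule bounded_linear_intro[where K="norm v"]) (auto simp: norm_vector_smult vector_sadd_rdistrib vec_eq_iff algebra_simps)
    then show ?thesis
      by (auto intro!: derivative_eq_intros bounded_linear_imp_has_derivative)
  qed
  from has_derivative_compose[OF this assms(1)]
  show ?thesis
    unfolding has_field_derivative_def assms(2) by (simp add: mult.commute[of _ "L v"] )
qed

lemma holomorphic_on_line:
  fixes u v :: "complex ^ 'n::finite"
  assumes "holomorphic_several_on f S" "\<And>t. t \<in> T \<Longrightarrow> u + t *s v \<in> S"
  shows "(\<lambda>t. f (u + t *s v)) holomorphic_on T"
  unfolding holomorphic_on_def
proof
  fix t assume t: "t \<in> T"
  from holomorphic_several_onD[OF assms(1) assms(2)[OF t]] obtain L where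
    L: "(f has_derivative L) (at (u + t *s v))" "\<And>c v. L (c *s v) = c * L v" by blast
  from holomorphic_several_on_has_field_derivative[OF L]
  show "(\<lambda>t. f (u + t *s v)) field_differentiable at t within T"
    unfolding field_differentiable_def by (blast intro: has_field_derivative_at_within)
qed

lemma holomorphic_on_slice:
  fixes z :: "complex ^ 'n::finite"
  assumes "holomorphic_several_on f unit_ball" "\<And>w. w \<in> T \<Longrightarrow> cmod w * norm z < 1"
  shows "(\<lambda>w. f (w *s z)) holomorphic_on T"
  using holomorphic_on_line[OF assms(1), of T 0 z] assms(2) by (simp add: norm_vector_smult)

lemma scaled_norm_less_1:
  "cmod w \<le> R \<Longrightarrow> R * norm z < 1 \<Longrightarrow> cmod w * norm z < 1"
  using mult_right_mono[of "cmod w" R "norm z"] by simp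

text \<open>
  The \<open>j\<close>-th homogeneous part of \<open>f\<close> at \<open>z\<close> is the \<open>j\<close>-th Taylor coefficient at \<open>0\<close> of the slice
  \<open>w \<mapsto> f (w z)\<close>. The slice is holomorphic near \<open>0\<close> for every vector \<open>z\<close>, so the homogeneous
  parts of a function on the ball are meaningful on the whole space.
\<close>
definition hom_part :: "(complex ^ 'n::finite \<Rightarrow> complex) \<Rightarrow> nat \<Rightarrow> complex ^ 'n \<Rightarrow> complex"
  where "hom_part f j z = (deriv ^^ j) (\<lambda>w. f (w *s z)) 0 / fact j"

lemma unit_ball_dilation:
  fixes z :: "'a::real_normed_vector"
  assumes "z \<in> ball 0 1"
  obtains R where "R > 1" "R * norm z < 1"
proof (cases "norm z = 0")
  case True then show ?thesis using that[of 2] by simp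
next
  case False
  with assms have "1 < 1 / norm z" by (simp add: divide_simps)
  then obtain R where "1 < R" "R < 1 / norm z" using dense by blast
  then show ?thesis using that[of R] False by (simp add: divide_simps)
qed
lemma slice_radius:
  fixes z :: "complex ^ 'n::finite"
  obtains r where "r > 0" "\<And>w. w \<in> ball 0 r \<Longrightarrow> cmod w * norm z < 1"
proof
  show "1 / (norm z + 1) > 0" by (smt (verit) norm_ge_zero divide_pos_pos)
  fix w :: complex assume "w \<in> ball 0 (1 / (norm z + 1))"
  then have "cmod w * (norm z + 1) < 1"
    by (smt (verit) mem_ball_0 norm_ge_zero pos_less_divide_eq)
  then show "cmod w * norm z < 1"
    by (smt (verit) mult_left_mono norm_ge_zero)
qed

lemma hom_part_smult:
  fixes z :: "complex ^ 'n::finite"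
  assumes f: "holomorphic_several_on f unit_ball"
  shows "hom_part f j (\<mu> *s z) = \<mu> ^ j * hom_part f j z"
proof -
  obtain r where r: "r > 0" "\<And>w. w \<in> ball 0 r \<Longrightarrow> cmod w * norm z < 1"
    using slice_radius by blast
  obtain r' where r': "r' > 0" "\<And>w. w \<in> ball 0 r' \<Longrightarrow> cmod w * cmod \<mu> < r"
  proof
    show "r / (cmod \<mu> + 1) > 0" using r by (smt (verit) norm_ge_zero divide_pos_pos)
    fix w :: complex assume "w \<in> ball 0 (r / (cmod \<mu> + 1))"
    then have "cmod w * (cmod \<mu> + 1) < r"
      by (smt (verit) mem_ball_0 norm_ge_zero pos_less_divide_eq)
    then show "cmod w * cmod \<mu> < r"
      by (smt (verit) mult_left_mono norm_ge_zero)
  qed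
  have "(deriv ^^ j) (\<lambda>w. (\<lambda>w. f (w *s z)) (\<mu> * w)) 0 = \<mu> ^ j * (deriv ^^ j) (\<lambda>w. f (w *s z)) (\<mu> * 0)"
    by (rule higher_deriv_compose_linear[where S="ball 0 r'" and T="ball 0 r"])
       (use r r' in \<open>auto intro!: holomorphic_on_slice[OF f] simp: norm_mult mult.commute\<close>)
  then show ?thesis by (simp add: hom_part_def mult.commute)
qed

lemma hom_part_bound:
  assumes f: "holomorphic_several_on f unit_ball" and z: "z \<in> unit_ball"
    and M: "\<And>w. cmod w = 1 \<Longrightarrow> cmod (f (w *s z)) \<le> M"
  shows "cmod (hom_part f j z) \<le> M"
proof -
  have hol: "(\<lambda>w. f (w *s z)) holomorphic_on cball 0 1"
    by (rule holomorphic_on_slice[OF f])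
       (use z in \<open>auto intro: scaled_norm_less_1[of _ 1]\<close>)
  have "norm ((deriv ^^ j) (\<lambda>w. f (w *s z)) 0) \<le> fact j * M / 1 ^ j"
    using holomorphic_on_imp_continuous_on[OF hol] holomorphic_on_subset[OF hol ball_subset_cball] M
    by (intro Cauchy_inequality) auto
  then show ?thesis
    by (simp add: hom_part_def norm_divide divide_simps mult.commute)
qed

lemma hom_part_sums:
  assumes f: "holomorphic_several_on f unit_ball" and z: "z \<in> unit_ball"
  shows "(\<lambda>j. hom_part f j z) sums f z"
proof -
  obtain R where R: "R > 1" "R * norm z < 1"
    using unit_ball_dilation[OF z] by blast
  have hol: "(\<lambda>w. f (w *s z)) holomorphic_on ball 0 R"
    by (rule holomorphic_on_slice[OF f])
       (use R in \<open>auto intro: scaled_norm_less_1[of _ R]\<close>)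
  have "((\<lambda>n. (deriv ^^ n) (\<lambda>w. f (w *s z)) 0 / (fact n) * (1 - 0)^n) sums f (1 *s z))"
    by (rule holomorphic_power_series[OF hol]) (use R in auto)
  then show ?thesis by (simp add: hom_part_def)
qed

lemma powser_coeff_unique:
  assumes "r > 0" "\<And>w. w \<in> ball 0 r \<Longrightarrow> (\<lambda>j. c j * w ^ j) sums \<phi> w"
  shows "(deriv ^^ j) \<phi> (0::complex) / fact j = c j"
proof -
  have "eventually (\<lambda>w. w \<in> ball 0 r) (nhds (0::complex))"
    using assms(1) by (intro eventually_nhds_in_open) auto
  then have "\<phi> has_fps_expansion Abs_fps c"
    by (intro has_fps_expansionI) (auto elim!: eventually_mono simp: assms(2))
  then show ?thesis
    by (metis fps_nth_Abs_fps fps_nth_fps_expansion)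
qed

lemma hom_part_unique:
  assumes "r > 0" "\<And>w. w \<in> ball 0 r \<Longrightarrow> (\<lambda>j. c j * w ^ j) sums f (w *s z)"
  shows "hom_part f j z = c j"
  unfolding hom_part_def by (rule powser_coeff_unique[OF assms])

section \<open>Homogeneous parts are polynomials\<close>

lemma bounded_on_compact_ball:
  fixes f :: "complex ^ 'n::finite \<Rightarrow> complex"
  assumes "holomorphic_several_on f unit_ball" "r < 1"
  obtains M where "M \<ge> 0" "\<And>z. norm z \<le> r \<Longrightarrow> cmod (f z) \<le> M"
proof -
  have "continuous_on (cball 0 r) f"
    using holomorphic_several_on_imp_continuous_on[OF assms(1)] assms(2)
    by (auto elim!: continuous_on_subset)
  then have "bounded (f ` cball 0 r)"
    by (intro compact_imp_bounded compact_continuous_image compact_cball)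
  then obtain M where "\<And>x. x \<in> cball 0 r \<Longrightarrow> cmod (f x) \<le> M"
    unfolding bounded_iff by blast
  then have "max M 0 \<ge> 0" "\<And>z. norm z \<le> r \<Longrightarrow> cmod (f z) \<le> max M 0"
    by (auto simp: le_max_iff_disj)
  then show ?thesis using that by blast
qed

text \<open>
  The homogeneous part of degree \<open>j\<close> is the limit of \<open>(f (x z) - (lower parts of f (x z))) / x ^ j\<close>
  as \<open>x \<rightarrow> 0\<close>, with an error that depends on \<open>z\<close> only through the bound \<open>M\<close>. By induction on \<open>j\<close>
  it is therefore, on the part of a complex line inside a small ball, a uniform limit of holomorphic
  functions.
\<close>
lemma hom_part_remainder:
  fixes z :: "complex ^ 'n::finite" and x :: real
  assumes f: "holomorphic_several_on f unit_ball" and z: "norm z < 1" and x: "0 < x" "x \<le> 1/2"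
    and M: "\<And>l. cmod (hom_part f l z) \<le> M"
  shows "cmod ((f (of_real x *s z) - (\<Sum>l<j. hom_part f l z * of_real x ^ l)) / of_real x ^ j
            - hom_part f j z) \<le> 2 * M * x"
proof -
  have M0: "M \<ge> 0" using M[of 0] norm_ge_zero order_trans by blast
  have "x * norm z < 1" using x z mult_left_le_one_le[of "norm z" x] by simp
  then have "of_real x *s z \<in> unit_ball" using x by (simp add: norm_vector_smult)
  from hom_part_sums[OF f this]
  have "(\<lambda>l. hom_part f l z * of_real x ^ l) sums f (of_real x *s z)"
    by (simp add: hom_part_smult[OF f] mult.commute)
  from sums_split_initial_segment[OF this, of "Suc j"]
  have s1: "(\<lambda>l. hom_part f (l + Suc j) z * of_real x ^ (l + Suc j)) sums
        (f (of_real x *s z) - (\<Sum>l<Suc j. hom_part f l z * of_real x ^ l))" .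
  have "(\<lambda>l. x ^ l) sums (1 / (1 - x))" using x by (intro geometric_sums) auto
  from sums_mult[OF this, of "M * x ^ Suc j"]
  have s2: "(\<lambda>l. M * x ^ (l + Suc j)) sums (M * x ^ Suc j * (1 / (1 - x)))"
    by (simp add: power_add mult_ac)
  have "cmod (f (of_real x *s z) - (\<Sum>l<Suc j. hom_part f l z * of_real x ^ l))
      \<le> M * x ^ Suc j * (1 / (1 - x))"
    by (rule norm_sums_le[OF s1 s2])
       (use x in \<open>auto simp: norm_mult norm_power intro!: mult_right_mono M simp del: power_Suc\<close>)
  also have "\<dots> \<le> M * x ^ Suc j * 2"
    using x M0 by (intro mult_left_mono) (auto simp: field_simps)
  finally have *: "cmod (f (of_real x *s z) - (\<Sum>l<Suc j. hom_part f l z * of_real x ^ l)) \<le> 2 * M * x * x ^ j"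
    by (simp add: mult_ac)
  have "(f (of_real x *s z) - (\<Sum>l<j. hom_part f l z * of_real x ^ l)) / of_real x ^ j - hom_part f j z
      = (f (of_real x *s z) - (\<Sum>l<Suc j. hom_part f l z * of_real x ^ l)) / of_real x ^ j"
    using x by (simp add: field_simps)
  then show ?thesis
    using * x by (simp add: norm_divide norm_power pos_divide_le_eq)
qed

lemma open_norm_line_less:
  fixes u v :: "complex ^ 'n::finite"
  shows "open {t. norm (u + t *s v) < r}"
proof -
  have "continuous_on UNIV (\<lambda>t. norm (u + t *s v))"
    unfolding vector_scalar_mult_def by (intro continuous_intros)
  then show ?thesis by (intro open_Collect_less continuous_on_const)
qed

lemma hom_part_holomorphic_small:
  fixes u v :: "complex ^ 'n::finite"
  assumes f: "holomorphic_several_on f unit_ball"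
  shows "(\<lambda>t. hom_part f j (u + t *s v)) holomorphic_on {t. norm (u + t *s v) < 1/2}"
proof (induction j rule: less_induct)
  case (less j)
  define S where "S = {t. norm (u + t *s v) < 1/2}"
  have openS: "open S"
    unfolding S_def by (rule open_norm_line_less)
  obtain M where M: "M \<ge> 0" "\<And>z. norm z \<le> 1/2 \<Longrightarrow> cmod (f z) \<le> M"
    using bounded_on_compact_ball[OF f, of "1/2"] by auto
  have HM: "cmod (hom_part f l z) \<le> M" if "norm z \<le> 1/2" for l z
    using that by (intro hom_part_bound[OF f]) (auto intro!: M(2) simp: norm_vector_smult)
  define x where "x = (\<lambda>n. 1 / real (n + 2))"
  have x: "0 < x n" "x n \<le> 1/2" for n by (auto simp: x_def field_simps)
  define F where "F = (\<lambda>n t. (f (of_real (x n) *s (u + t *s v)) -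
      (\<Sum>l<j. hom_part f l (u + t *s v) * of_real (x n) ^ l)) / of_real (x n) ^ j)"
  show ?case unfolding S_def[symmetric]
  proof (rule holomorphic_uniform_sequence[OF openS])
    fix n
    have "(\<lambda>t. f (of_real (x n) *s u + t *s (of_real (x n) *s v))) holomorphic_on S"
    proof (rule holomorphic_on_line[OF f])
      fix t assume "t \<in> S"
      then have "norm (u + t *s v) < 1/2" by (simp add: S_def)
      moreover have "of_real (x n) *s u + t *s (of_real (x n) *s v) = of_real (x n) *s (u + t *s v)"
        by (simp add: vec_eq_iff algebra_simps)
      ultimately show "of_real (x n) *s u + t *s (of_real (x n) *s v) \<in> unit_ball"
        using x[of n] mult_mono[of "x n" 1 "norm (u + t *s v)" "1/2"]
        by (simp only: mem_ball_0 norm_vector_smult norm_of_real) simp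
    qed
    moreover have "of_real (x n) *s u + t *s (of_real (x n) *s v) = of_real (x n) *s (u + t *s v)" for t
      by (simp add: vec_eq_iff algebra_simps)
    ultimately have "(\<lambda>t. f (of_real (x n) *s (u + t *s v))) holomorphic_on S" by (simp only:)
    then show "F n holomorphic_on S"
      unfolding F_def using less[folded S_def] x[of n]
      by (intro holomorphic_intros) auto
  next
    fix t assume "t \<in> S"
    then obtain d where d: "d > 0" "cball t d \<subseteq> S"
      using openS open_contains_cball by blast
    have "uniform_limit S F (\<lambda>t. hom_part f j (u + t *s v)) sequentially"
    proof (rule uniform_limitI)
      fix e :: real assume e: "e > 0"
      have "(\<lambda>n. 2 * M * x n) \<longlonglongrightarrow> 2 * M * 0"
        unfolding x_def using LIMSEQ_ignore_initial_segment[OF lim_1_over_n, of 2]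
        by (intro tendsto_mult tendsto_const) simp
      then have "eventually (\<lambda>n. 2 * M * x n < e) sequentially"
        using e by (intro order_tendstoD) auto
      then show "\<forall>\<^sub>F n in sequentially. \<forall>t\<in>S. dist (F n t) (hom_part f j (u + t *s v)) < e"
      proof eventually_elim
        case (elim n)
        show ?case
        proof
          fix t assume "t \<in> S"
          then have "norm (u + t *s v) < 1/2" by (simp add: S_def)
          then have "dist (F n t) (hom_part f j (u + t *s v)) \<le> 2 * M * x n"
            unfolding dist_norm F_def
            by (intro hom_part_remainder[OF f] x HM) auto
          with elim show "dist (F n t) (hom_part f j (u + t *s v)) < e" by simp
        qed
      qed
    qed
    with d show "\<exists>d>0. cball t d \<subseteq> S \<and>
        uniform_limit (cball t d) F (\<lambda>t. hom_part f j (u + t *s v)) sequentially"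
      using uniform_limit_on_subset by blast
  qed
qed

lemma hom_part_rescale:
  fixes z :: "complex ^ 'n::finite"
  assumes f: "holomorphic_several_on f unit_ball" and "\<mu> \<noteq> 0"
  shows "hom_part f j z = (1 / \<mu>) ^ j * hom_part f j (\<mu> *s z)"
  using assms(2) by (simp add: hom_part_smult[OF f] power_divide)

text \<open>
  By homogeneity, holomorphy on lines near the origin propagates to the whole space.
\<close>
lemma hom_part_holomorphic_line:
  fixes u v :: "complex ^ 'n::finite"
  assumes f: "holomorphic_several_on f unit_ball"
  shows "(\<lambda>t. hom_part f j (u + t *s v)) holomorphic_on UNIV"
proof -
  have "(\<lambda>t. hom_part f j (u + t *s v)) field_differentiable at s" for s
  proof -
    define m where "m = 1 / (2 * (norm (u + s *s v) + 1))"
    have pos: "norm (u + s *s v) + 1 > 0" by (smt (verit) norm_ge_zero)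
    then have m: "m > 0" by (simp add: m_def)
    have ms: "m * norm (u + s *s v) < 1/2"
      using pos by (simp add: m_def divide_simps)
    define \<mu> :: complex where "\<mu> = of_real m"
    have \<mu>: "\<mu> \<noteq> 0" "cmod \<mu> = m" using m by (auto simp: \<mu>_def)
    define T where "T = {t. norm (\<mu> *s u + t *s (\<mu> *s v)) < 1/2}"
    have eq: "\<mu> *s u + t *s (\<mu> *s v) = \<mu> *s (u + t *s v)" for t
      by (simp add: vec_eq_iff algebra_simps)
    have openT: "open T"
      unfolding T_def by (rule open_norm_line_less)
    have sT: "s \<in> T" using ms \<mu> unfolding T_def eq by (simp only: mem_Collect_eq norm_vector_smult)
    have "(\<lambda>t. (1 / \<mu>) ^ j * hom_part f j (\<mu> *s u + t *s (\<mu> *s v))) holomorphic_on T"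
      unfolding T_def by (intro holomorphic_intros hom_part_holomorphic_small f)
    then have "(\<lambda>t. hom_part f j (u + t *s v)) holomorphic_on T"
      unfolding eq hom_part_rescale[OF f \<mu>(1), symmetric] .
    then show ?thesis using sT openT holomorphic_on_imp_differentiable_at by blast
  qed
  then show ?thesis
    by (simp add: holomorphic_on_def)
qed

text \<open>
  On a complex line the homogeneous part of degree \<open>j\<close> is an entire function of growth at most
  \<open>\<bar>t\<bar> ^ j\<close>, hence a polynomial by Liouville's theorem.
\<close>
lemma hom_part_line_polynomial:
  fixes u v :: "complex ^ 'n::finite"
  assumes f: "holomorphic_several_on f unit_ball"
  shows "\<exists>q. \<forall>t. hom_part f j (u + t *s v) = (\<Sum>k\<le>j. q k * t ^ k)"
proof -
  obtain M where M: "M \<ge> 0" "\<And>z. norm z \<le> 1/2 \<Longrightarrow> cmod (f z) \<le> M"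
    using bounded_on_compact_ball[OF f, of "1/2"] by auto
  have HM: "cmod (hom_part f l z) \<le> M" if "norm z \<le> 1/2" for l z
    using that by (intro hom_part_bound[OF f]) (auto intro!: M(2) simp: norm_vector_smult)
  have growth: "cmod (hom_part f j z) \<le> M * (2 * (norm z + 1)) ^ j" for z
  proof -
    define m where "m = 1 / (2 * (norm z + 1))"
    have pos: "norm z + 1 > 0" by (smt (verit) norm_ge_zero)
    then have m: "m > 0" "m * norm z \<le> 1/2" by (auto simp: m_def divide_simps)
    have "hom_part f j z = (1 / of_real m) ^ j * hom_part f j (of_real m *s z)"
      using m by (intro hom_part_rescale[OF f]) auto
    also have "cmod \<dots> \<le> (1 / m) ^ j * M"
      unfolding norm_mult using m
      by (intro mult_mono HM) (auto simp: norm_power norm_divide norm_vector_smult)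
    finally show ?thesis by (simp add: m_def mult.commute)
  qed
  define A where "A = norm u + norm v + 1"
  have "hom_part f j (u + t *s v) =
     (\<Sum>k\<le>j. (deriv ^^ k) (\<lambda>t. hom_part f j (u + t *s v)) 0 / fact k * t ^ k)" for t
  proof (rule Liouville_polynomial[OF hom_part_holomorphic_line[OF f], where A=1 and B="M * (2 * A) ^ j"])
    fix t :: complex assume t: "1 \<le> norm t"
    have "norm (u + t *s v) + 1 \<le> norm u + norm t * norm v + 1"
      using norm_triangle_ineq[of u "t *s v"] by (simp add: norm_vector_smult)
    also have "\<dots> \<le> A * norm t"
    proof -
      have "norm u * 1 \<le> norm u * norm t" using t by (intro mult_left_mono) auto
      then show ?thesis using t by (simp add: A_def algebra_simps)
    qed
    finally have "(2 * (norm (u + t *s v) + 1)) ^ j \<le> (2 * A * norm t) ^ j"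
      by (intro power_mono) auto
    then have "M * (2 * (norm (u + t *s v) + 1)) ^ j \<le> M * (2 * A * norm t) ^ j"
      using M by (intro mult_left_mono)
    with growth[of "u + t *s v"] show "cmod (hom_part f j (u + t *s v)) \<le> M * (2 * A) ^ j * norm t ^ j"
      by (simp add: power_mult_distrib mult_ac)
  qed
  then show ?thesis
    by (intro exI[of _ "\<lambda>k. (deriv ^^ k) (\<lambda>t. hom_part f j (u + t *s v)) 0 / fact k"] allI)
qed

lemma mi_power_add: "mi_power z (\<lambda>i. k i + l i) = mi_power z k * mi_power z l"
  by (simp add: mi_power_def power_add prod.distrib)

lemma mi_power_smult: "mi_power (c *s z) k = c ^ mi_abs k * mi_power z k"
  by (simp add: mi_power_def mi_abs_def power_mult_distrib prod.distrib power_sum)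

lemma complex_polynomialsI:
  "finite K \<Longrightarrow> (\<lambda>z. \<Sum>k\<in>K. c k * mi_power z k) \<in> complex_polynomials"
  unfolding complex_polynomials_def by blast

lemma complex_polynomials_monomial: "(\<lambda>z. c * mi_power z k) \<in> complex_polynomials"
  unfolding complex_polynomials_def by (auto intro!: exI[of _ "{k}"] exI[of _ "\<lambda>_. c"])

lemma complex_polynomials_const: "(\<lambda>z. c) \<in> complex_polynomials"
  using complex_polynomials_monomial[of c "\<lambda>_. 0"] by (simp add: mi_power_def)

lemma complex_polynomials_component: "(\<lambda>z. z $ i) \<in> complex_polynomials"
proof -
  have "mi_power z (\<lambda>m. if m = i then 1 else 0) = z $ i" for z :: "complex ^ 'a"
    by (simp add: mi_power_def if_distrib[of "\<lambda>e. _ ^ e"] cong: if_cong)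
  then show ?thesis using complex_polynomials_monomial[of 1 "\<lambda>m. if m = i then 1 else 0"] by simp
qed

lemma complex_polynomials_add:
  assumes "p \<in> complex_polynomials" "q \<in> complex_polynomials"
  shows "(\<lambda>z. p z + q z) \<in> complex_polynomials"
proof -
  from assms obtain K c L d where *: "finite K" "p = (\<lambda>z. \<Sum>k\<in>K. c k * mi_power z k)"
     "finite L" "q = (\<lambda>z. \<Sum>k\<in>L. d k * mi_power z k)"
    unfolding complex_polynomials_def by blast
  have "p z = (\<Sum>k\<in>K\<union>L. (if k \<in> K then c k else 0) * mi_power z k)" for z
    unfolding * by (intro sum.mono_neutral_cong_left) (use * in auto)
  moreover have "q z = (\<Sum>k\<in>K\<union>L. (if k \<in> L then d k else 0) * mi_power z k)" for z
    unfolding * by (intro sum.mono_neutral_cong_left) (use * in auto)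
  ultimately have "(\<lambda>z. p z + q z) = (\<lambda>z. \<Sum>k\<in>K\<union>L.
      ((if k \<in> K then c k else 0) + (if k \<in> L then d k else 0)) * mi_power z k)"
    by (simp only: sum.distrib distrib_right)
  then show ?thesis
    using complex_polynomialsI[OF finite_UnI[OF *(1,3)]] by (simp only:)
qed

lemma complex_polynomials_sum:
  "(\<And>i. i \<in> I \<Longrightarrow> f i \<in> complex_polynomials) \<Longrightarrow> (\<lambda>z. \<Sum>i\<in>I. f i z) \<in> complex_polynomials"
  by (induction I rule: infinite_finite_induct)
     (auto intro: complex_polynomials_const complex_polynomials_add)

lemma complex_polynomials_mult:
  assumes "p \<in> complex_polynomials" "q \<in> complex_polynomials"
  shows "(\<lambda>z. p z * q z) \<in> complex_polynomials"
proof -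
  from assms obtain K c L d where *: "p = (\<lambda>z. \<Sum>k\<in>K. c k * mi_power z k)"
     "q = (\<lambda>z. \<Sum>k\<in>L. d k * mi_power z k)"
    unfolding complex_polynomials_def by blast
  have "(\<lambda>z. p z * q z) = (\<lambda>z. \<Sum>k\<in>K. \<Sum>l\<in>L. c k * d l * mi_power z (\<lambda>i. k i + l i))"
    unfolding * sum_product mi_power_add by (simp only: mult_ac)
  then show ?thesis
    by (simp only:) (intro complex_polynomials_sum complex_polynomials_monomial)
qed

lemma complex_polynomials_power:
  "p \<in> complex_polynomials \<Longrightarrow> (\<lambda>z. p z ^ m) \<in> complex_polynomials"
  by (induction m) (auto intro: complex_polynomials_const complex_polynomials_mult)

lemma complex_polynomials_poly: "(\<lambda>z. poly q (z $ i)) \<in> complex_polynomials"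
  unfolding poly_altdef
  by (intro complex_polynomials_sum complex_polynomials_mult complex_polynomials_const
      complex_polynomials_power complex_polynomials_component)

text \<open>
  Lagrange interpolation at the nodes \<open>0, \<dots>, d\<close>, with basis polynomials \<open>B l\<close>.
\<close>
lemma lagrange_interpolation:
  fixes q :: "nat \<Rightarrow> complex" and d :: nat
  defines "B \<equiv> (\<lambda>l. \<Prod>m\<in>{..d} - {l}. smult (1 / (of_nat l - of_nat m)) [:- of_nat m, 1:] :: complex poly)"
  assumes q: "\<And>t. F t = (\<Sum>k\<le>d. q k * t ^ k)"
  shows "F t = (\<Sum>l\<le>d. F (of_nat l) * poly (B l) t)"
proof -
  define P where "P = (\<Sum>k\<le>d. monom (q k) k)"
  have P: "poly P s = F s" for s by (simp add: P_def poly_sum poly_monom q)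
  define R where "R = (\<Sum>l\<le>d. smult (F (of_nat l)) (B l))"
  have "P = R"
  proof (rule poly_eqI_degree[where A = "of_nat ` {..d}"])
    have c: "card (of_nat ` {..d} :: complex set) = Suc d"
      by (subst card_image) (auto simp: inj_on_def)
    have "degree P \<le> d"
      unfolding P_def by (intro degree_sum_le) (auto intro: order_trans[OF degree_monom_le])
    then show "degree P < card (of_nat ` {..d} :: complex set)" using c by simp
    have "degree (B l) \<le> d" if "l \<le> d" for l
    proof -
      have "degree (B l) \<le> (\<Sum>m\<in>{..d} - {l}. degree (smult (1 / (of_nat l - of_nat m)) [:- of_nat m, 1:] :: complex poly))"
        unfolding B_def by (rule order_trans[OF degree_prod_sum_le]) (simp_all add: o_def)
      also have "\<dots> \<le> (\<Sum>m\<in>{..d} - {l}. 1)" by (intro sum_mono) simp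
      also have "\<dots> = d" using that by simp
      finally show ?thesis .
    qed
    then have "degree R \<le> d"
      unfolding R_def by (intro degree_sum_le) (auto intro: order_trans[OF degree_smult_le])
    then show "degree R < card (of_nat ` {..d} :: complex set)" using c by simp
    fix s :: complex assume "s \<in> of_nat ` {..d}"
    then obtain n where n: "n \<le> d" "s = of_nat n" by auto
    have "poly (B l) s = (if l = n then 1 else 0)" if "l \<le> d" for l
    proof (cases "l = n")
      case True
      have "1 / (of_nat n - of_nat m) * (of_nat n - of_nat m) = (1 :: complex)" if "m \<noteq> n" for m :: nat
        using that by simp
      then show ?thesis
        unfolding B_def poly_prod n
        by (auto simp: True intro!: prod.neutral simp flip: diff_divide_distrib)
    next
      case False
      then show ?thesis unfolding B_def poly_prod n using n by auto
    qed
    then have "poly R s = (\<Sum>l\<le>d. if l = n then F (of_nat l) else 0)"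
      unfolding R_def poly_sum by (intro sum.cong) auto
    then show "poly P s = poly R s" using n by (simp add: P)
  qed
  then have "F t = poly R t" using P by metis
  then show ?thesis by (simp add: R_def poly_sum)
qed

text \<open>
  The vector \<open>z\<close> with its \<open>i\<close>-th coordinate replaced by \<open>t\<close>.
\<close>
definition vec_upd :: "complex ^ 'n \<Rightarrow> 'n \<Rightarrow> complex \<Rightarrow> complex ^ 'n"
  where "vec_upd z i t = (\<chi> m. if m = i then t else z $ m)"

text \<open>
  A function that is polynomial of degree at most \<open>d\<close> in each variable separately is a polynomial:
  interpolation in one variable writes it as a combination of functions that no longer depend on
  that variable, and induction on the set of variables applies to these.
\<close>
lemma separately_polynomial:
  fixes F :: "complex ^ 'n::finite \<Rightarrow> complex"
  assumes "\<And>i z. \<exists>q. \<forall>t. F (vec_upd z i t) = (\<Sum>k\<le>d. q k * t ^ k)"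
  shows "F \<in> complex_polynomials"
proof -
  have "F \<in> complex_polynomials"
    if "finite I" "\<And>i z. \<exists>q. \<forall>t. F (vec_upd z i t) = (\<Sum>k\<le>d. q k * t ^ k)"
       "\<And>z z'. (\<forall>i\<in>I. z $ i = z' $ i) \<Longrightarrow> F z = F z'"
    for I :: "'n set" and F
    using that
  proof (induction I arbitrary: F rule: finite_induct)
    case empty
    then have "F = (\<lambda>_. F 0)" by blast
    then show ?case using complex_polynomials_const by metis
  next
    case (insert i I)
    define B where "B = (\<lambda>l. \<Prod>m\<in>{..d} - {l}. smult (1 / (of_nat l - of_nat m)) [:- of_nat m, 1:] :: complex poly)"
    have "F = (\<lambda>z. \<Sum>l\<le>d. F (vec_upd z i (of_nat l)) * poly (B l) (z $ i))"
    proof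
      fix z
      have "F z = F (vec_upd z i (z $ i))" by (rule arg_cong[of _ _ F]) (simp add: vec_upd_def vec_eq_iff)
      moreover obtain q where "\<And>t. F (vec_upd z i t) = (\<Sum>k\<le>d. q k * t ^ k)"
        using insert.prems(1) by blast
      ultimately show "F z = (\<Sum>l\<le>d. F (vec_upd z i (of_nat l)) * poly (B l) (z $ i))"
        using lagrange_interpolation[of "\<lambda>t. F (vec_upd z i t)" q d "z $ i"] by (simp add: B_def)
    qed
    moreover have "(\<lambda>z. F (vec_upd z i s)) \<in> complex_polynomials" for s
    proof (rule insert.IH)
      fix j z
      show "\<exists>q. \<forall>t. F (vec_upd (vec_upd z j t) i s) = (\<Sum>k\<le>d. q k * t ^ k)"
      proof (cases "j = i")
        case True
        have "vec_upd (vec_upd z j t) i s = vec_upd z i s" for t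
          using True by (simp add: vec_upd_def vec_eq_iff)
        then show ?thesis
          by (intro exI[of _ "\<lambda>k. if k = 0 then F (vec_upd z i s) else 0"])
             (auto simp: if_distrib[of "\<lambda>a. a * _"] sum.delta cong: if_cong)
      next
        case False
        have "vec_upd (vec_upd z j t) i s = vec_upd (vec_upd z i s) j t" for t
          using False by (simp add: vec_upd_def vec_eq_iff)
        then show ?thesis using insert.prems(1)[of "vec_upd z i s" j] by simp
      qed
    next
      fix z z' :: "complex ^ 'n"
      assume "\<forall>i\<in>I. z $ i = z' $ i"
      then show "F (vec_upd z i s) = F (vec_upd z' i s)"
        by (intro insert.prems(2)) (auto simp: vec_upd_def)
    qed
    ultimately show ?case
      by (elim ssubst[of F]) (intro complex_polynomials_sum complex_polynomials_mult complex_polynomials_poly)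
  qed
  from this[OF finite_class.finite_UNIV assms] show ?thesis
    using vec_eq_iff UNIV_I by metis
qed

lemma mi_abs_component_le: "k i \<le> mi_abs (k :: 'n::finite \<Rightarrow> nat)"
  unfolding mi_abs_def by (rule member_le_sum) auto
lemma finite_mi_abs_le: "finite {k :: 'n::finite \<Rightarrow> nat. mi_abs k \<le> j}"
proof (rule finite_subset)
  show "{k :: 'n \<Rightarrow> nat. mi_abs k \<le> j} \<subseteq> PiE UNIV (\<lambda>_. {..j})"
  proof (intro subsetI PiE_I)
    fix k i assume "k \<in> {k :: 'n \<Rightarrow> nat. mi_abs k \<le> j}"
    moreover have "k i \<le> mi_abs k" by (rule mi_abs_component_le)
    ultimately show "k i \<in> {..j}" by simp
  qed auto
qed (auto intro: finite_PiE)

lemma finite_mi_abs_eq: "finite {k :: 'n::finite \<Rightarrow> nat. mi_abs k = j}"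
  by (rule finite_subset[OF _ finite_mi_abs_le[of j]]) auto

lemma hom_part_polynomial:
  fixes f :: "complex ^ 'n::finite \<Rightarrow> complex"
  assumes f: "holomorphic_several_on f unit_ball"
  shows "hom_part f j \<in> complex_polynomials"
proof (rule separately_polynomial)
  fix i :: 'n and z :: "complex ^ 'n"
  have "vec_upd z i t = vec_upd z i 0 + t *s axis i 1" for t
    by (simp add: vec_upd_def vec_eq_iff axis_def)
  then show "\<exists>q. \<forall>t. hom_part f j (vec_upd z i t) = (\<Sum>k\<le>j. q k * t ^ k)"
    using hom_part_line_polynomial[OF f] by metis
qed

lemma hom_part_homogeneous_polynomial:
  fixes f :: "complex ^ 'n::finite \<Rightarrow> complex"
  assumes f: "holomorphic_several_on f unit_ball"
  shows "\<exists>b. \<forall>z. hom_part f j z = (\<Sum>k | mi_abs k = j. b k * mi_power z k)"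
proof -
  obtain K c where K: "finite K" "\<And>z. hom_part f j z = (\<Sum>k\<in>K. c k * mi_power z k)"
    using hom_part_polynomial[OF f, of j] unfolding complex_polynomials_def by auto
  have "hom_part f j z = (\<Sum>k | mi_abs k = j. (if k \<in> K then c k else 0) * mi_power z k)" for z
  proof -
    \<comment> \<open>Both sides are the homogeneous part at \<open>w z\<close>, as polynomials in \<open>w\<close>; the coefficient of \<open>w ^ j\<close>
      selects the multi-indices of degree \<open>j\<close>.\<close>
    have "monom (hom_part f j z) j = (\<Sum>k\<in>K. monom (c k * mi_power z k) (mi_abs k))"
    proof -
      have "poly (monom (hom_part f j z) j) w = poly (\<Sum>k\<in>K. monom (c k * mi_power z k) (mi_abs k)) w" for w
        using hom_part_smult[OF f, of j w z] K(2)[of "w *s z"]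
        by (simp add: poly_monom poly_sum mi_power_smult mult_ac)
      then show ?thesis using poly_eq_poly_eq_iff by blast
    qed
    then have "coeff (monom (hom_part f j z) j) j = coeff (\<Sum>k\<in>K. monom (c k * mi_power z k) (mi_abs k)) j"
      by simp
    then have "hom_part f j z = (\<Sum>k\<in>K. if mi_abs k = j then c k * mi_power z k else 0)"
      by (simp add: coeff_sum)
    also have "\<dots> = (\<Sum>k\<in>K \<inter> {k. mi_abs k = j}. c k * mi_power z k)"
      using K by (simp add: sum.If_cases)
    also have "\<dots> = (\<Sum>k | mi_abs k = j. (if k \<in> K then c k else 0) * mi_power z k)"
      by (intro sum.mono_neutral_cong_left) (auto simp: finite_mi_abs_eq)
    finally show ?thesis .
  qed
  then show ?thesis by (intro exI[of _ "\<lambda>k. if k \<in> K then c k else 0"]) blast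
qed

section \<open>Power series coefficients\<close>

lemma sum_cis_orthogonal:
  fixes N a b :: nat
  assumes "a < N" "b < N"
  shows "(\<Sum>p<N. cis (2 * pi * real p / real N) ^ a * cnj (cis (2 * pi * real p / real N) ^ b))
    = (if a = b then of_nat N else 0)"
proof -
  define x where "x = cis (2 * pi * (real a - real b) / real N)"
  have "cis (2 * pi * real p / real N) ^ a * cnj (cis (2 * pi * real p / real N) ^ b) = x ^ p" for p
    by (simp only: complex_cnj_power cis_cnj Complex.DeMoivre cis_mult x_def)
       (rule arg_cong[of _ _ cis], use assms in \<open>simp add: field_simps\<close>)
  then have eq: "(\<Sum>p<N. cis (2 * pi * real p / real N) ^ a * cnj (cis (2 * pi * real p / real N) ^ b))
     = (\<Sum>p<N. x ^ p)" by simp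
  show ?thesis
  proof (cases "a = b")
    case True
    then show ?thesis unfolding eq by (simp add: x_def)
  next
    case False
    have "x ^ N = cis (2 * pi * of_int (int a - int b))"
      using assms by (simp add: x_def Complex.DeMoivre)
    also have "\<dots> = 1" by (rule cis_multiple_2pi) simp
    finally have xN: "x ^ N = 1" .
    have "x \<noteq> 1"
    proof
      assume "x = 1"
      then have "cos (2 * pi * (real a - real b) / real N) = 1"
        by (simp add: x_def complex_eq_iff)
      then obtain m :: int where "2 * pi * (real a - real b) / real N = of_int m * 2 * pi"
        unfolding cos_one_2pi_int by blast
      then have "2 * pi * (real a - real b) = 2 * pi * (of_int m * real N)"
        using assms by (simp add: field_simps)
      then have "real a - real b = of_int m * real N" by (simp only: mult_cancel_left) simp
      then have m: "int a - int b = m * int N"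
        by (metis of_int_diff of_int_eq_iff of_int_mult of_int_of_nat_eq)
      have "\<bar>int a - int b\<bar> < int N" using assms by linarith
      then have "\<bar>m\<bar> * int N < 1 * int N" by (simp add: m abs_mult)
      then have "m = 0" by (simp only: mult_less_cancel_right) auto
      with m False show False by simp
    qed
    then have "(\<Sum>p<N. x ^ p) = 0" by (simp add: geometric_sum xN)
    then show ?thesis unfolding eq using False by simp
  qed
qed

text \<open>
  Cauchy's inequality for one coefficient of a polynomial that is bounded on a torus. The coefficient
  is recovered by averaging over the points of the torus whose arguments are \<open>N\<close>-th roots of unity;
  this is exact because \<open>N\<close> exceeds all the exponents that occur.
\<close>
lemma torus_coeff_bound:
  fixes b :: "('n::finite \<Rightarrow> nat) \<Rightarrow> complex" and r :: "'n \<Rightarrow> real"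
  assumes K: "finite K" "k0 \<in> K" and r: "\<And>i. r i \<ge> 0"
    and M: "\<And>z. (\<And>i. cmod (z $ i) = r i) \<Longrightarrow> cmod (\<Sum>k\<in>K. b k * mi_power z k) \<le> M"
  shows "cmod (b k0) * (\<Prod>i\<in>UNIV. r i ^ k0 i) \<le> M"
proof -
  define N where "N = Suc (\<Sum>k\<in>K. mi_abs k)"
  have N: "k i < N" if "k \<in> K" for k i
  proof -
    have "k i \<le> mi_abs k" by (rule mi_abs_component_le)
    also have "\<dots> \<le> (\<Sum>k\<in>K. mi_abs k)" using K that by (intro member_le_sum) auto
    finally show ?thesis by (simp add: N_def)
  qed
  define \<zeta> where "\<zeta> = (\<lambda>p. cis (2 * pi * real p / real N))"
  define z where "z = (\<lambda>p. \<chi> i. of_real (r i) * \<zeta> (p i))"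
  define E where "E = (\<lambda>(p :: 'n \<Rightarrow> nat) k. \<Prod>i\<in>UNIV. \<zeta> (p i) ^ k i)"
  define X where "X = PiE (UNIV :: 'n set) (\<lambda>_. {..<N})"
  have zE: "mi_power (z p) k = of_real (\<Prod>i\<in>UNIV. r i ^ k i) * E p k" for p k
    by (simp add: mi_power_def z_def E_def power_mult_distrib prod.distrib)
  have orth: "(\<Sum>p\<in>X. E p k * cnj (E p k0)) = (if k = k0 then of_nat N ^ CARD('n) else 0)"
    if k: "k \<in> K" for k
  proof -
    have "(\<Sum>p\<in>X. E p k * cnj (E p k0)) = (\<Sum>p\<in>X. \<Prod>i\<in>UNIV. \<zeta> (p i) ^ k i * cnj (\<zeta> (p i) ^ k0 i))"
      by (simp add: E_def prod.distrib cnj_prod)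
    also have "\<dots> = (\<Prod>i\<in>UNIV. \<Sum>p<N. \<zeta> p ^ k i * cnj (\<zeta> p ^ k0 i))"
      unfolding X_def by (rule prod_sum_PiE[symmetric]) auto
    also have "\<dots> = (\<Prod>i\<in>UNIV. if k i = k0 i then of_nat N else 0)"
      unfolding \<zeta>_def by (intro prod.cong refl sum_cis_orthogonal N k K)
    also have "\<dots> = (if k = k0 then of_nat N ^ CARD('n) else 0)"
    proof (cases "k = k0")
      case False
      then obtain i where "k i \<noteq> k0 i" by blast
      then have "(\<Prod>i\<in>UNIV. if k i = k0 i then of_nat N else 0) = (0::complex)"
        by (intro prod_zero) auto
      with False show ?thesis by simp
    qed simp
    finally show ?thesis .
  qed
  have cardX: "card X = N ^ CARD('n)" by (simp add: X_def card_PiE)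
  have "(\<Sum>p\<in>X. (\<Sum>k\<in>K. b k * mi_power (z p) k) * cnj (E p k0))
      = (\<Sum>k\<in>K. \<Sum>p\<in>X. b k * of_real (\<Prod>i\<in>UNIV. r i ^ k i) * (E p k * cnj (E p k0)))"
    unfolding sum_distrib_right zE by (subst sum.swap) (simp only: mult_ac)
  also have "\<dots> = (\<Sum>k\<in>K. b k * of_real (\<Prod>i\<in>UNIV. r i ^ k i) * (\<Sum>p\<in>X. E p k * cnj (E p k0)))"
    by (simp only: sum_distrib_left)
  also have "\<dots> = (\<Sum>k\<in>K. if k = k0 then b k * of_real (\<Prod>i\<in>UNIV. r i ^ k i) * of_nat N ^ CARD('n) else 0)"
    by (intro sum.cong refl) (simp add: orth)
  also have "\<dots> = b k0 * of_real (\<Prod>i\<in>UNIV. r i ^ k0 i) * of_nat N ^ CARD('n)"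
    using K by (simp add: sum.delta)
  finally have "cmod (b k0 * of_real (\<Prod>i\<in>UNIV. r i ^ k0 i) * of_nat N ^ CARD('n))
     = cmod (\<Sum>p\<in>X. (\<Sum>k\<in>K. b k * mi_power (z p) k) * cnj (E p k0))" by simp
  also have "\<dots> \<le> (\<Sum>p\<in>X. M)"
  proof (rule sum_norm_le)
    fix p assume "p \<in> X"
    have "cmod (E p k0) = 1" by (simp add: E_def \<zeta>_def prod_norm norm_power flip: prod_norm)
    moreover have "cmod (\<Sum>k\<in>K. b k * mi_power (z p) k) \<le> M"
      by (rule M) (use r in \<open>simp add: z_def norm_mult \<zeta>_def\<close>)
    ultimately show "cmod ((\<Sum>k\<in>K. b k * mi_power (z p) k) * cnj (E p k0)) \<le> M"
      by (simp add: norm_mult)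
  qed
  also have "\<dots> = M * real N ^ CARD('n)" by (simp add: cardX)
  finally have "cmod (b k0) * (\<Prod>i\<in>UNIV. r i ^ k0 i) * real N ^ CARD('n) \<le> M * real N ^ CARD('n)"
    using r by (simp add: norm_mult norm_power prod_nonneg flip: prod_norm)
  moreover have "N > 0" by (simp add: N_def)
  ultimately show ?thesis by (elim mult_right_le_imp_le) simp
qed

lemma summable_on_multiindex_prod:
  fixes u :: "nat \<Rightarrow> real"
  assumes "\<And>l. u l \<ge> 0" "summable u"
  shows "(\<lambda>k :: 'n::finite \<Rightarrow> nat. \<Prod>i\<in>UNIV. u (k i)) summable_on UNIV"
proof (rule nonneg_bdd_above_summable_on)
  show "bdd_above (sum (\<lambda>k :: 'n \<Rightarrow> nat. \<Prod>i\<in>UNIV. u (k i)) ` {F. F \<subseteq> UNIV \<and> finite F})"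
  proof (rule bdd_aboveI2)
    fix F :: "('n \<Rightarrow> nat) set" assume "F \<in> {F. F \<subseteq> UNIV \<and> finite F}"
    then have F: "finite F" by simp
    define J where "J = (\<Sum>k\<in>F. mi_abs k)"
    have "k i \<le> J" if "k \<in> F" for k i
    proof -
      have "k i \<le> mi_abs k" by (rule mi_abs_component_le)
      also have "\<dots> \<le> J" unfolding J_def using F that by (intro member_le_sum) auto
      finally show ?thesis .
    qed
    then have "(\<Sum>k\<in>F. \<Prod>i\<in>UNIV. u (k i)) \<le> (\<Sum>k\<in>PiE (UNIV :: 'n set) (\<lambda>_. {..J}). \<Prod>i\<in>UNIV. u (k i))"
      by (intro sum_mono2) (auto intro!: finite_PiE prod_nonneg assms)
    also have "\<dots> = (\<Prod>i\<in>(UNIV :: 'n set). \<Sum>l\<le>J. u l)"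
      by (rule prod_sum_PiE[symmetric]) auto
    also have "\<dots> \<le> (\<Prod>i\<in>(UNIV :: 'n set). suminf u)"
      using assms by (intro prod_mono) (auto intro!: sum_nonneg sum_le_suminf)
    finally show "(\<Sum>k\<in>F. \<Prod>i\<in>UNIV. u (k i)) \<le> (\<Prod>i\<in>(UNIV :: 'n set). suminf u)" .
  qed
qed (auto intro!: prod_nonneg assms)

lemma has_sum_group_by_degree:
  fixes c :: "('n::finite \<Rightarrow> nat) \<Rightarrow> complex"
  assumes "(c has_sum S) UNIV"
  shows "(\<lambda>j. \<Sum>k | mi_abs k = j. c k) sums S"
proof -
  have "bij_betw snd (Sigma UNIV (\<lambda>j. {k :: 'n \<Rightarrow> nat. mi_abs k = j})) UNIV"
    by (rule bij_betwI[where g="\<lambda>k. (mi_abs k, k)"]) auto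
  then have "((\<lambda>p. c (snd p)) has_sum S) (Sigma UNIV (\<lambda>j. {k. mi_abs k = j}))"
    using has_sum_reindex_bij_betw assms by fast
  then have "((\<lambda>j. \<Sum>k | mi_abs k = j. c k) has_sum S) UNIV"
    by (rule has_sum_SigmaD) (simp add: finite_mi_abs_eq)
  then show ?thesis by (rule has_sum_imp_sums)
qed

text \<open>
  The coefficients of the homogeneous parts form the power series of \<open>f\<close>. Its absolute convergence
  at \<open>z\<close> follows from the bound on the coefficients over the torus through \<open>s z\<close> for some \<open>s > 1\<close>.
\<close>
lemma power_series_exists:
  fixes f :: "complex ^ 'n::finite \<Rightarrow> complex"
  assumes f: "holomorphic_several_on f unit_ball"
  shows "\<exists>a. (\<forall>j z. hom_part f j z = (\<Sum>k | mi_abs k = j. a k * mi_power z k)) \<and>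
           (\<forall>z\<in>unit_ball. ((\<lambda>k. a k * mi_power z k) has_sum f z) UNIV)"
proof -
  obtain b where b: "\<And>j z. hom_part f j z = (\<Sum>k | mi_abs k = j. b j k * mi_power z k)"
    using hom_part_homogeneous_polynomial[OF f] by metis
  define a where "a = (\<lambda>k. b (mi_abs k) k)"
  have a: "hom_part f j z = (\<Sum>k | mi_abs k = j. a k * mi_power z k)" for j z
    unfolding b by (intro sum.cong) (auto simp: a_def)
  have "((\<lambda>k. a k * mi_power z k) has_sum f z) UNIV" if z: "z \<in> unit_ball" for z
  proof -
    obtain s where s: "s > 1" "s * norm z < 1"
      using unit_ball_dilation[OF z] by blast
    obtain M where M: "M \<ge> 0" "\<And>w. norm w \<le> s * norm z \<Longrightarrow> cmod (f w) \<le> M"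
      using bounded_on_compact_ball[OF f s(2)] by auto
    have bound: "cmod (a k * mi_power z k) \<le> M * (\<Prod>i\<in>UNIV. (1 / s) ^ k i)" for k
    proof -
      have "cmod (a k) * (\<Prod>i\<in>UNIV. (s * cmod (z $ i)) ^ k i) \<le> M"
      proof (rule torus_coeff_bound[where K="{l. mi_abs l = mi_abs k}"])
        fix w :: "complex ^ 'n"
        assume w: "\<And>i. cmod (w $ i) = s * cmod (z $ i)"
        have "norm w = norm (of_real s *s z)"
          unfolding norm_vec_def using s by (simp add: w norm_mult)
        then have nw: "norm w = s * norm z" using s by (simp add: norm_vector_smult)
        then have "cmod (hom_part f (mi_abs k) w) \<le> M"
          by (intro hom_part_bound[OF f] M) (use s in \<open>auto simp: norm_vector_smult\<close>)
        then show "cmod (\<Sum>l | mi_abs l = mi_abs k. a l * mi_power w l) \<le> M"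
          by (simp add: a)
      qed (use s in \<open>auto simp: finite_mi_abs_eq\<close>)
      moreover have "cmod (a k * mi_power z k) = cmod (a k) * (\<Prod>i\<in>UNIV. (s * cmod (z $ i)) ^ k i) * (\<Prod>i\<in>UNIV. (1 / s) ^ k i)"
        using s by (simp add: norm_mult mi_power_def norm_power mult.assoc power_mult_distrib power_divide
             flip: prod_norm prod.distrib)
      ultimately show ?thesis
        using s by (simp only:) (intro mult_right_mono prod_nonneg, auto)
    qed
    have "(\<lambda>k :: 'n \<Rightarrow> nat. \<Prod>i\<in>UNIV. (1 / s) ^ k i) summable_on UNIV"
      using s by (intro summable_on_multiindex_prod summable_geometric) auto
    then have "(\<lambda>k. M * (\<Prod>i\<in>UNIV. (1 / s) ^ k i)) summable_on (UNIV :: ('n \<Rightarrow> nat) set)"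
      by (rule summable_on_cmult_right)
    then have "(\<lambda>k. norm (a k * mi_power z k)) summable_on UNIV"
      by (rule Infinite_Sum.abs_summable_on_comparison_test') (use bound in auto)
    then have "(\<lambda>k. a k * mi_power z k) summable_on UNIV"
      by (rule abs_summable_summable)
    then obtain S where S: "((\<lambda>k. a k * mi_power z k) has_sum S) UNIV"
      unfolding summable_on_def by blast
    from has_sum_group_by_degree[OF this] have "(\<lambda>j. hom_part f j z) sums S" by (simp add: a)
    with hom_part_sums[OF f z] have "S = f z" using sums_unique2 by blast
    with S show ?thesis by simp
  qed
  with a show ?thesis by blast
qed

lemma hom_part_of_power_series:
  fixes f :: "complex ^ 'n::finite \<Rightarrow> complex"
  assumes a: "\<And>z. z \<in> unit_ball \<Longrightarrow> ((\<lambda>k. a k * mi_power z k) has_sum f z) UNIV"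
    and z: "z \<in> unit_ball"
  shows "hom_part f j z = (\<Sum>k | mi_abs k = j. a k * mi_power z k)"
proof (rule hom_part_unique[of 1 "\<lambda>j. \<Sum>k | mi_abs k = j. a k * mi_power z k"])
  fix w :: complex assume w: "w \<in> ball 0 1"
  then have "w *s z \<in> unit_ball"
    using z mult_strict_mono[of "cmod w" 1 "norm z" 1] by (simp add: norm_vector_smult)
  from has_sum_group_by_degree[OF a[OF this]]
  have "(\<lambda>j. \<Sum>k | mi_abs k = j. a k * mi_power (w *s z) k) sums f (w *s z)" .
  moreover have "(\<Sum>k | mi_abs k = j. a k * mi_power (w *s z) k)
     = (\<Sum>k | mi_abs k = j. a k * mi_power z k) * w ^ j" for j
    unfolding sum_distrib_right by (intro sum.cong) (auto simp: mi_power_smult)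
  ultimately show "(\<lambda>j. (\<Sum>k | mi_abs k = j. a k * mi_power z k) * w ^ j) sums f (w *s z)"
    by simp
qed simp

lemma power_series_unique:
  fixes f :: "complex ^ 'n::finite \<Rightarrow> complex"
  assumes a: "\<And>z. z \<in> unit_ball \<Longrightarrow> ((\<lambda>k. a k * mi_power z k) has_sum f z) UNIV"
    and b: "\<And>z. z \<in> unit_ball \<Longrightarrow> ((\<lambda>k. b k * mi_power z k) has_sum f z) UNIV"
  shows "a = b"
proof
  fix k :: "'n \<Rightarrow> nat"
  \<comment> \<open>The torus of all points with coordinates of modulus \<open>\<rho>\<close> lies in the ball.\<close>
  define \<rho> where "\<rho> = 1 / (real CARD('n) + 1)"
  have \<rho>: "\<rho> > 0" "real CARD('n) * \<rho> < 1" by (auto simp: \<rho>_def field_simps add_pos_nonneg)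
  have "cmod (a k - b k) * (\<Prod>i\<in>UNIV. \<rho> ^ k i) \<le> 0"
  proof (rule torus_coeff_bound[where K="{l. mi_abs l = mi_abs k}" and b="\<lambda>k. a k - b k"])
    fix z :: "complex ^ 'n" assume z: "\<And>i. cmod (z $ i) = \<rho>"
    have "norm z \<le> (\<Sum>i\<in>UNIV. cmod (z $ i))"
      unfolding norm_vec_def by (rule L2_set_le_sum) auto
    then have "z \<in> unit_ball" using \<rho> by (simp add: z)
    from hom_part_of_power_series[OF a this] hom_part_of_power_series[OF b this]
    show "cmod (\<Sum>l | mi_abs l = mi_abs k. (a l - b l) * mi_power z l) \<le> 0"
      by (simp add: left_diff_distrib sum_subtractf)
  qed (use \<rho> in \<open>auto simp: finite_mi_abs_eq\<close>)
  moreover have "(\<Prod>i\<in>UNIV. \<rho> ^ k i) > 0" using \<rho> by (intro prod_pos) auto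
  ultimately have "cmod (a k - b k) \<le> 0" by (simp add: mult_le_0_iff)
  then show "a k = b k" by simp
qed

lemma power_series_coeff_eqI:
  fixes f :: "complex ^ 'n::finite \<Rightarrow> complex"
  assumes a: "\<And>z. z \<in> unit_ball \<Longrightarrow> ((\<lambda>k. a k * mi_power z k) has_sum f z) UNIV"
  shows "power_series_coeff f = a"
  unfolding power_series_coeff_def
proof (rule the_equality)
  show "\<forall>z\<in>unit_ball. ((\<lambda>k. a k * mi_power z k) has_sum f z) UNIV" using a by blast
next
  fix b assume "\<forall>z\<in>unit_ball. ((\<lambda>k. b k * mi_power z k) has_sum f z) UNIV"
  then show "b = a" by (intro power_series_unique[of b f a]) (auto simp: a)
qed

lemma power_series_coeff_has_sum:
  assumes "holomorphic_several_on f unit_ball" "z \<in> unit_ball"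
  shows "((\<lambda>k. power_series_coeff f k * mi_power z k) has_sum f z) UNIV"
  using power_series_exists[OF assms(1)] power_series_coeff_eqI assms(2) by metis

lemma hom_part_eq_power_series_coeff:
  assumes "holomorphic_several_on f unit_ball"
  shows "hom_part f j z = (\<Sum>k | mi_abs k = j. power_series_coeff f k * mi_power z k)"
  using power_series_exists[OF assms] power_series_coeff_eqI by metis

lemma power_series_coeff_add:
  assumes f: "holomorphic_several_on f unit_ball" and g: "holomorphic_several_on g unit_ball"
  shows "power_series_coeff (\<lambda>z. f z + g z) k = power_series_coeff f k + power_series_coeff g k"
proof -
  have "power_series_coeff (\<lambda>z. f z + g z) = (\<lambda>k. power_series_coeff f k + power_series_coeff g k)"
  proof (rule power_series_coeff_eqI)
    fix z :: "complex ^ 'a" assume "z \<in> unit_ball"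
    from has_sum_add[OF power_series_coeff_has_sum[OF f this] power_series_coeff_has_sum[OF g this]]
    show "((\<lambda>k. (power_series_coeff f k + power_series_coeff g k) * mi_power z k) has_sum f z + g z) UNIV"
      by (simp add: algebra_simps)
  qed
  then show ?thesis by simp
qed

lemma power_series_coeff_diff:
  assumes f: "holomorphic_several_on f unit_ball" and g: "holomorphic_several_on g unit_ball"
  shows "power_series_coeff (\<lambda>z. f z - g z) k = power_series_coeff f k - power_series_coeff g k"
  using power_series_coeff_add[OF holomorphic_several_on_diff[OF f g] g, of k] by simp

section \<open>Families on the disc with uniformly bounded derivatives\<close>

lemma has_derivative_zero_of_square_bound:
  fixes f :: "'a::real_normed_vector \<Rightarrow> 'b::real_normed_vector"
    and F :: "'a \<Rightarrow> 'c::real_normed_vector"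
  assumes f: "(f has_derivative L) (at z)" "f z = 0"
    and F: "F z = 0" "open S" "z \<in> S" "\<And>w. w \<in> S \<Longrightarrow> norm (F w) \<le> C * norm (f w) ^ 2" "C \<ge> 0"
  shows "(F has_derivative (\<lambda>_. 0)) (at z)"
proof -
  obtain e where e: "e > 0" "ball z e \<subseteq> S" using F open_contains_ball by blast
  obtain K where K: "\<And>v. norm (L v) \<le> norm v * K" "K \<ge> 0"
    using bounded_linear.nonneg_bounded[OF has_derivative_bounded_linear[OF f(1)]] by blast
  define R where "R = (\<lambda>y. norm (f y - f z - L (y - z)) / norm (y - z))"
  have R: "(R \<longlongrightarrow> 0) (at z)"
    using f(1) unfolding has_derivative_iff_norm R_def by blast
  have f0: "((\<lambda>y. norm (f y)) \<longlongrightarrow> 0) (at z)"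
    using has_derivative_continuous[OF f(1)] f(2) by (metis isContD norm_zero tendsto_norm)
  have "((\<lambda>y. C * norm (f y) * (R y + K)) \<longlongrightarrow> C * 0 * (0 + K)) (at z)"
    by (intro tendsto_intros R f0)
  then have lim: "((\<lambda>y. C * norm (f y) * (R y + K)) \<longlongrightarrow> 0) (at z)" by simp
  show ?thesis
  proof (rule has_derivativeI_sandwich[OF e(1) bounded_linear_zero _ lim])
    fix y assume y: "y \<noteq> z" "dist y z < e"
    have "norm (f y) \<le> norm (f y - f z - L (y - z)) + norm (L (y - z))"
      using norm_triangle_ineq[of "f y - f z - L (y - z)" "L (y - z)"] by (simp add: f)
    also have "\<dots> \<le> R y * norm (y - z) + norm (y - z) * K"
      using y K by (simp add: R_def)
    finally have "norm (f y) \<le> (R y + K) * norm (y - z)" by (simp add: algebra_simps)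
    then have "C * norm (f y) * norm (f y) \<le> C * norm (f y) * ((R y + K) * norm (y - z))"
      using F by (intro mult_left_mono) auto
    moreover have "norm (F y) \<le> C * norm (f y) ^ 2"
      using y e by (intro F) (auto simp: dist_commute)
    ultimately have "norm (F y) \<le> C * norm (f y) * (R y + K) * norm (y - z)"
      by (simp add: power2_eq_square mult.assoc)
    then show "norm (F y - F z - 0) / norm (y - z) \<le> C * norm (f y) * (R y + K)"
      using y F by (simp add: pos_divide_le_eq)
  qed
qed

text \<open>
  A family of holomorphic functions on the unit disc, indexed by \<open>I\<close>, whose derivatives up to
  order \<open>m\<close> are bounded on the disc, uniformly over the family. It is used for the slices
  \<open>w \<mapsto> f (w z)\<close>, indexed by the points \<open>z\<close> of the ball.
\<close>
definition bounded_derivs :: "nat \<Rightarrow> 'i set \<Rightarrow> ('i \<Rightarrow> complex \<Rightarrow> complex) \<Rightarrow> bool"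
  where "bounded_derivs m I u \<longleftrightarrow>
    (\<forall>i\<in>I. u i holomorphic_on ball 0 1) \<and>
    (\<forall>l\<le>m. \<exists>C. \<forall>i\<in>I. \<forall>w\<in>ball 0 1. cmod ((deriv ^^ l) (u i) w) \<le> C)"

lemma bounded_derivs_holomorphic:
  "bounded_derivs m I u \<Longrightarrow> i \<in> I \<Longrightarrow> u i holomorphic_on ball 0 1"
  by (simp add: bounded_derivs_def)

lemma bounded_derivs_mono: "bounded_derivs m I u \<Longrightarrow> m' \<le> m \<Longrightarrow> bounded_derivs m' I u"
  by (auto simp: bounded_derivs_def)

lemma bounded_derivs_0:
  "bounded_derivs 0 I u \<longleftrightarrow> (\<forall>i\<in>I. u i holomorphic_on ball 0 1) \<and>
     (\<exists>C. \<forall>i\<in>I. \<forall>w\<in>ball 0 1. cmod (u i w) \<le> C)"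
  by (simp add: bounded_derivs_def)

lemma bounded_derivs_Suc:
  "bounded_derivs (Suc m) I u \<longleftrightarrow> bounded_derivs 0 I u \<and> bounded_derivs m I (\<lambda>i. deriv (u i))"
proof -
  have "(\<forall>l\<le>Suc m. \<exists>C. \<forall>i\<in>I. \<forall>w\<in>ball 0 1. cmod ((deriv ^^ l) (u i) w) \<le> C) \<longleftrightarrow>
    (\<exists>C. \<forall>i\<in>I. \<forall>w\<in>ball 0 1. cmod (u i w) \<le> C) \<and>
    (\<forall>l\<le>m. \<exists>C. \<forall>i\<in>I. \<forall>w\<in>ball 0 1. cmod ((deriv ^^ l) (deriv (u i)) w) \<le> C)"
  proof -
    have "(\<forall>l\<le>Suc m. P l) \<longleftrightarrow> P 0 \<and> (\<forall>l\<le>m. P (Suc l))" for P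
      by (metis Suc_le_mono not0_implies_Suc zero_le)
    from this[of "\<lambda>l. \<exists>C. \<forall>i\<in>I. \<forall>w\<in>ball 0 1. cmod ((deriv ^^ l) (u i) w) \<le> C"]
    show ?thesis unfolding funpow_Suc_right o_def by simp
  qed
  then show ?thesis
    by (auto simp: bounded_derivs_def intro: holomorphic_deriv)
qed

lemma bounded_derivs_cong:
  assumes u: "bounded_derivs m I u" and eq: "\<And>i w. i \<in> I \<Longrightarrow> w \<in> ball 0 1 \<Longrightarrow> u i w = v i w"
  shows "bounded_derivs m I v"
proof -
  have hol: "u i holomorphic_on ball 0 1" "v i holomorphic_on ball 0 1" if "i \<in> I" for i
  proof -
    show "u i holomorphic_on ball 0 1" using u that by (simp add: bounded_derivs_def)
    then show "v i holomorphic_on ball 0 1" using holomorphic_transform eq[OF that] by blast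
  qed
  have "(deriv ^^ l) (u i) w = (deriv ^^ l) (v i) w" if "i \<in> I" "w \<in> ball 0 1" for i w l
    by (rule higher_deriv_transform_within_open[OF hol[OF that(1)] open_ball that(2) eq[OF that(1)]])
  then show ?thesis using u hol by (simp add: bounded_derivs_def)
qed

lemma bounded_derivs_const:
  assumes "\<And>i. i \<in> I \<Longrightarrow> cmod (c i) \<le> C"
  shows "bounded_derivs m I (\<lambda>i w. c i)"
  using assms
proof (induction m arbitrary: c C)
  case 0
  then show ?case by (auto simp: bounded_derivs_0)
next
  case (Suc m)
  have "bounded_derivs m I (\<lambda>i w. 0)" by (rule Suc.IH[of _ 0]) simp
  then show ?case using Suc.prems by (auto simp: bounded_derivs_Suc bounded_derivs_0)
qed

lemma bounded_derivs_add:
  assumes "bounded_derivs m I u" "bounded_derivs m I v"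
  shows "bounded_derivs m I (\<lambda>i w. u i w + v i w)"
  using assms
proof (induction m arbitrary: u v)
  case 0
  then obtain C D where "\<forall>i\<in>I. \<forall>w\<in>ball 0 1. cmod (u i w) \<le> C" "\<forall>i\<in>I. \<forall>w\<in>ball 0 1. cmod (v i w) \<le> D"
    unfolding bounded_derivs_0 by blast
  then have "\<forall>i\<in>I. \<forall>w\<in>ball 0 1. cmod (u i w + v i w) \<le> C + D"
    by (meson norm_triangle_mono)
  with 0 show ?case unfolding bounded_derivs_0 by (blast intro: holomorphic_intros)
next
  case (Suc m)
  have "bounded_derivs m I u" "bounded_derivs m I v"
    using Suc.prems bounded_derivs_mono le_SucI by blast+
  then have "bounded_derivs 0 I (\<lambda>i w. u i w + v i w)"
    using bounded_derivs_mono[OF Suc.IH] by simp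
  moreover have "bounded_derivs m I (\<lambda>i. deriv (\<lambda>w. u i w + v i w))"
  proof (rule bounded_derivs_cong)
    show "bounded_derivs m I (\<lambda>i w. deriv (u i) w + deriv (v i) w)"
      using Suc by (simp add: bounded_derivs_Suc)
    fix i :: 'a and w :: complex assume "i \<in> I" "w \<in> ball 0 1"
    then show "deriv (u i) w + deriv (v i) w = deriv (\<lambda>w. u i w + v i w) w"
      using Suc.prems bounded_derivs_holomorphic holomorphic_on_imp_differentiable_at[OF _ open_ball]
      by (metis deriv_add)
  qed
  ultimately show ?case by (simp add: bounded_derivs_Suc)
qed

lemma bounded_derivs_mult:
  assumes "bounded_derivs m I u" "bounded_derivs m I v"
  shows "bounded_derivs m I (\<lambda>i w. u i w * v i w)"
  using assms
proof (induction m arbitrary: u v)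
  case 0
  then obtain C D where *: "\<forall>i\<in>I. \<forall>w\<in>ball 0 1. cmod (u i w) \<le> C" "\<forall>i\<in>I. \<forall>w\<in>ball 0 1. cmod (v i w) \<le> D"
    unfolding bounded_derivs_0 by blast
  have "\<forall>i\<in>I. \<forall>w\<in>ball 0 1. cmod (u i w * v i w) \<le> C * D"
  proof (intro ballI)
    fix i and w :: complex assume "i \<in> I" "w \<in> ball 0 1"
    with * have "cmod (u i w) \<le> C" "cmod (v i w) \<le> D" by blast+
    moreover from this(1) have "0 \<le> C" using norm_ge_zero order_trans by blast
    ultimately show "cmod (u i w * v i w) \<le> C * D"
      unfolding norm_mult by (intro mult_mono) auto
  qed
  with 0 show ?case unfolding bounded_derivs_0 by (blast intro: holomorphic_intros)
next
  case (Suc m)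
  have le: "bounded_derivs m I u" "bounded_derivs m I v"
    using Suc.prems bounded_derivs_mono le_SucI by blast+
  have "bounded_derivs 0 I (\<lambda>i w. u i w * v i w)"
    using bounded_derivs_mono[OF Suc.IH[OF le]] by simp
  moreover have "bounded_derivs m I (\<lambda>i. deriv (\<lambda>w. u i w * v i w))"
  proof (rule bounded_derivs_cong)
    show "bounded_derivs m I (\<lambda>i w. u i w * deriv (v i) w + deriv (u i) w * v i w)"
      using Suc le by (intro bounded_derivs_add Suc.IH) (simp_all add: bounded_derivs_Suc)
    fix i :: 'a and w :: complex assume "i \<in> I" "w \<in> ball 0 1"
    then show "u i w * deriv (v i) w + deriv (u i) w * v i w = deriv (\<lambda>w. u i w * v i w) w"
      using Suc.prems bounded_derivs_holomorphic holomorphic_on_imp_differentiable_at[OF _ open_ball]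
      by (metis deriv_mult)
  qed
  ultimately show ?case by (simp add: bounded_derivs_Suc)
qed

lemma bounded_derivs_sum:
  "(\<And>k. k \<in> K \<Longrightarrow> bounded_derivs m I (u k)) \<Longrightarrow> bounded_derivs m I (\<lambda>i w. \<Sum>k\<in>K. u k i w)"
  by (induction K rule: infinite_finite_induct)
     (auto intro!: bounded_derivs_add bounded_derivs_const[of _ _ 0])

lemma bounded_derivs_prod:
  "(\<And>k. k \<in> K \<Longrightarrow> bounded_derivs m I (u k)) \<Longrightarrow> bounded_derivs m I (\<lambda>i w. \<Prod>k\<in>K. u k i w)"
  by (induction K rule: infinite_finite_induct)
     (auto intro!: bounded_derivs_mult bounded_derivs_const[of _ _ 1])

lemma bounded_derivs_power:
  "bounded_derivs m I u \<Longrightarrow> bounded_derivs m I (\<lambda>i w. u i w ^ a)"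
  by (induction a) (auto intro!: bounded_derivs_mult bounded_derivs_const[of _ _ 1])

lemma bounded_derivs_linear:
  assumes "\<And>i. i \<in> I \<Longrightarrow> cmod (c i) \<le> C"
  shows "bounded_derivs m I (\<lambda>i w. w * c i)"
proof (intro bounded_derivs_mult bounded_derivs_const[OF assms])
  show "bounded_derivs m I (\<lambda>i w. w)"
  proof (cases m)
    case 0
    then show ?thesis by (auto simp: bounded_derivs_0 intro!: exI[of _ 1] holomorphic_intros)
  next
    case (Suc m')
    have "bounded_derivs m' I (\<lambda>i w. 1)" by (rule bounded_derivs_const[of _ _ 1]) simp
    then show ?thesis
      by (auto simp: Suc bounded_derivs_Suc bounded_derivs_0 intro!: exI[of _ 1] holomorphic_intros)
  qed
qed

text \<open>
  Division by zero gives zero here and below. For functions \<open>\<bar>x\<bar> \<le> \<bar>y\<bar>\<close>, bounded \<open>p\<close>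
  and \<open>a > b\<close> this is the limit of \<open>x ^ a p / y ^ b\<close> at the zeros of \<open>y\<close>.
\<close>
lemma power_quotient_bound:
  fixes x y p :: complex
  assumes "cmod x \<le> cmod y" "a \<ge> b"
  shows "cmod (x ^ a * p / y ^ b) \<le> cmod p * cmod y ^ (a - b)"
proof (cases "y = 0")
  case True
  with assms have "x = 0" by simp
  with True show ?thesis by (cases "b = 0"; cases "a = 0") (auto simp: norm_mult power_0_left)
next
  case False
  have "cmod x ^ a \<le> cmod y ^ a" using assms by (intro power_mono) auto
  also have "\<dots> = cmod y ^ (a - b) * cmod y ^ b" using assms by (simp flip: power_add)
  finally have "cmod x ^ a / cmod y ^ b \<le> cmod y ^ (a - b)"
    using False by (simp add: pos_divide_le_eq)
  then have "cmod p * (cmod x ^ a / cmod y ^ b) \<le> cmod p * cmod y ^ (a - b)"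
    by (intro mult_left_mono) auto
  then show ?thesis by (simp add: norm_mult norm_divide norm_power mult.commute)
qed

text \<open>
  The quotient rule for \<open>\<gamma> ^ a \<psi> / \<phi> ^ b\<close> holds also at the zeros of \<open>\<phi>\<close>: the function is
  \<open>O(\<bar>\<phi>\<bar>\<^sup>2)\<close> there, so its derivative vanishes, as do the three terms on the right. Each of these
  terms is again a quotient of the same shape, with the excess \<open>a - b\<close> lowered by at most one.
\<close>
lemma power_quotient_has_derivative:
  assumes hol: "\<phi> holomorphic_on ball 0 1" "\<gamma> holomorphic_on ball 0 1" "\<psi> holomorphic_on ball 0 1"
    and le: "\<And>w. w \<in> ball 0 1 \<Longrightarrow> cmod (\<gamma> w) \<le> cmod (\<phi> w)"
    and a: "a \<ge> b + 2" and w: "w \<in> ball 0 1"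
    and bd: "\<And>w. w \<in> ball 0 1 \<Longrightarrow> cmod (\<phi> w) \<le> A" "\<And>w. w \<in> ball 0 1 \<Longrightarrow> cmod (\<psi> w) \<le> B"
  shows "((\<lambda>w. \<gamma> w ^ a * \<psi> w / \<phi> w ^ b) has_field_derivative
      (\<gamma> w ^ (a - 1) * (of_nat a * (deriv \<gamma> w * \<psi> w)) / \<phi> w ^ b + \<gamma> w ^ a * deriv \<psi> w / \<phi> w ^ b
        + \<gamma> w ^ a * (- of_nat b * (\<psi> w * deriv \<phi> w)) / \<phi> w ^ (b + 1))) (at w)"
proof -
  have D: "(\<phi> has_field_derivative deriv \<phi> w) (at w)" "(\<gamma> has_field_derivative deriv \<gamma> w) (at w)"
    "(\<psi> has_field_derivative deriv \<psi> w) (at w)"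
    using hol w holomorphic_derivI[OF _ open_ball] by blast+
  show ?thesis
  proof (cases "\<phi> w = 0")
    case False
    have "((\<lambda>w. \<gamma> w ^ a * \<psi> w / \<phi> w ^ b) has_field_derivative
       (((of_nat a * (deriv \<gamma> w * \<gamma> w ^ (a - 1))) * \<psi> w + \<gamma> w ^ a * deriv \<psi> w) * \<phi> w ^ b
         - (\<gamma> w ^ a * \<psi> w) * (of_nat b * (deriv \<phi> w * \<phi> w ^ (b - 1)))) / (\<phi> w ^ b * \<phi> w ^ b)) (at w)"
      using False by (auto intro!: derivative_eq_intros D simp: algebra_simps)
    moreover have "(((of_nat a * (deriv \<gamma> w * \<gamma> w ^ (a - 1))) * \<psi> w + \<gamma> w ^ a * deriv \<psi> w) * \<phi> w ^ b
         - (\<gamma> w ^ a * \<psi> w) * (of_nat b * (deriv \<phi> w * \<phi> w ^ (b - 1)))) / (\<phi> w ^ b * \<phi> w ^ b)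
        = \<gamma> w ^ (a - 1) * (of_nat a * (deriv \<gamma> w * \<psi> w)) / \<phi> w ^ b + \<gamma> w ^ a * deriv \<psi> w / \<phi> w ^ b
        + \<gamma> w ^ a * (- of_nat b * (\<psi> w * deriv \<phi> w)) / \<phi> w ^ (b + 1)"
      using False by (cases b) (simp_all add: field_simps)
    ultimately show ?thesis by simp
  next
    case True
    with le[OF w] have \<gamma>0: "\<gamma> w = 0" by simp
    have A: "A \<ge> 0" using bd(1)[OF w] norm_ge_zero order_trans by blast
    have B: "B \<ge> 0" using bd(2)[OF w] norm_ge_zero order_trans by blast
    have "((\<lambda>w. \<gamma> w ^ a * \<psi> w / \<phi> w ^ b) has_derivative (\<lambda>_. 0)) (at w)"
    proof (rule has_derivative_zero_of_square_bound)
      show "(\<phi> has_derivative (*) (deriv \<phi> w)) (at w)" using D(1) by (simp add: has_field_derivative_def)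
      show "open (ball (0::complex) 1)" by simp
      show "0 \<le> B * A ^ (a - b - 2)" using A B by simp
      fix x :: complex assume x: "x \<in> ball 0 1"
      have "cmod (\<gamma> x ^ a * \<psi> x / \<phi> x ^ b) \<le> cmod (\<psi> x) * cmod (\<phi> x) ^ (a - b)"
        using le[OF x] a by (intro power_quotient_bound) auto
      also have "a - b = (a - b - 2) + 2" using a by simp
      also have "cmod (\<psi> x) * cmod (\<phi> x) ^ ((a - b - 2) + 2) = cmod (\<psi> x) * cmod (\<phi> x) ^ (a - b - 2) * cmod (\<phi> x)^2"
        by (simp only: power_add mult.assoc)
      also have "\<dots> \<le> B * A ^ (a - b - 2) * cmod (\<phi> x)^2"
        using bd[OF x] A B by (intro mult_right_mono mult_mono power_mono) auto
      finally show "cmod (\<gamma> x ^ a * \<psi> x / \<phi> x ^ b) \<le> B * A ^ (a - b - 2) * cmod (\<phi> x)^2" .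
    qed (use w True \<gamma>0 a in auto)
    moreover have "\<gamma> w ^ (a - 1) * (of_nat a * (deriv \<gamma> w * \<psi> w)) / \<phi> w ^ b + \<gamma> w ^ a * deriv \<psi> w / \<phi> w ^ b
        + \<gamma> w ^ a * (- of_nat b * (\<psi> w * deriv \<phi> w)) / \<phi> w ^ (b + 1) = 0"
    proof -
      have "\<gamma> w ^ (a - 1) = 0" "\<gamma> w ^ a = 0" using \<gamma>0 a by auto
      then show ?thesis by (simp only: mult_zero_left div_0 add_0_left)
    qed
    ultimately show ?thesis unfolding has_field_derivative_def by (simp only: lambda_zero)
  qed
qed

lemma bounded_derivs_0_power_quotient:
  assumes "bounded_derivs 0 I \<phi>" "bounded_derivs 0 I \<gamma>" "bounded_derivs 0 I \<psi>"
    and le: "\<And>i w. i \<in> I \<Longrightarrow> w \<in> ball 0 1 \<Longrightarrow> cmod (\<gamma> i w) \<le> cmod (\<phi> i w)"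
    and a: "a \<ge> b + 2"
  shows "bounded_derivs 0 I (\<lambda>i w. \<gamma> i w ^ a * \<psi> i w / \<phi> i w ^ b)"
    and "i \<in> I \<Longrightarrow> w \<in> ball 0 1 \<Longrightarrow> ((\<lambda>w. \<gamma> i w ^ a * \<psi> i w / \<phi> i w ^ b) has_field_derivative
      (\<gamma> i w ^ (a - 1) * (of_nat a * (deriv (\<gamma> i) w * \<psi> i w)) / \<phi> i w ^ b
        + \<gamma> i w ^ a * deriv (\<psi> i) w / \<phi> i w ^ b
        + \<gamma> i w ^ a * (- of_nat b * (\<psi> i w * deriv (\<phi> i) w)) / \<phi> i w ^ (b + 1))) (at w)"
proof -
  obtain A B where AB: "\<And>i w. i \<in> I \<Longrightarrow> w \<in> ball 0 1 \<Longrightarrow> cmod (\<phi> i w) \<le> A"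
      "\<And>i w. i \<in> I \<Longrightarrow> w \<in> ball 0 1 \<Longrightarrow> cmod (\<psi> i w) \<le> B"
    using assms(1,3) unfolding bounded_derivs_0 by meson
  show D: "((\<lambda>w. \<gamma> i w ^ a * \<psi> i w / \<phi> i w ^ b) has_field_derivative
      (\<gamma> i w ^ (a - 1) * (of_nat a * (deriv (\<gamma> i) w * \<psi> i w)) / \<phi> i w ^ b
        + \<gamma> i w ^ a * deriv (\<psi> i) w / \<phi> i w ^ b
        + \<gamma> i w ^ a * (- of_nat b * (\<psi> i w * deriv (\<phi> i) w)) / \<phi> i w ^ (b + 1))) (at w)"
    if "i \<in> I" "w \<in> ball 0 1" for i w
    using that by (intro power_quotient_has_derivative[OF _ _ _ le a _ AB])
                  (auto intro: bounded_derivs_holomorphic[OF assms(1)]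
                    bounded_derivs_holomorphic[OF assms(2)] bounded_derivs_holomorphic[OF assms(3)])
  have "cmod (\<gamma> i w ^ a * \<psi> i w / \<phi> i w ^ b) \<le> B * A ^ (a - b)" if "i \<in> I" "w \<in> ball 0 1" for i w
  proof -
    have "cmod (\<gamma> i w ^ a * \<psi> i w / \<phi> i w ^ b) \<le> cmod (\<psi> i w) * cmod (\<phi> i w) ^ (a - b)"
      using le[OF that] a by (intro power_quotient_bound) auto
    also have "\<dots> \<le> B * A ^ (a - b)"
      using AB[OF that] by (intro mult_mono power_mono) (auto intro: order_trans[OF norm_ge_zero])
    finally show ?thesis .
  qed
  moreover have "(\<lambda>w. \<gamma> i w ^ a * \<psi> i w / \<phi> i w ^ b) holomorphic_on ball 0 1" if "i \<in> I" for i
    unfolding holomorphic_on_open[OF open_ball] using D[OF that] by blast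
  ultimately show "bounded_derivs 0 I (\<lambda>i w. \<gamma> i w ^ a * \<psi> i w / \<phi> i w ^ b)"
    unfolding bounded_derivs_0 by blast
qed

text \<open>
  The central estimate: each derivative of \<open>\<gamma> ^ a \<psi> / \<phi> ^ b\<close> costs one power of \<open>\<gamma> / \<phi>\<close>, so the
  derivatives up to order \<open>m\<close> stay bounded when \<open>a\<close> is large enough.
\<close>
lemma bounded_derivs_power_quotient:
  assumes "bounded_derivs m I \<phi>" "bounded_derivs m I \<gamma>" "bounded_derivs m I \<psi>"
    and le: "\<And>i w. i \<in> I \<Longrightarrow> w \<in> ball 0 1 \<Longrightarrow> cmod (\<gamma> i w) \<le> cmod (\<phi> i w)"
    and a: "a \<ge> b + m + 2"
  shows "bounded_derivs m I (\<lambda>i w. \<gamma> i w ^ a * \<psi> i w / \<phi> i w ^ b)"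
  using assms(1-3) a
proof (induction m arbitrary: \<psi> a b)
  case (0 \<psi> a b)
  then show ?case using le by (intro bounded_derivs_0_power_quotient(1)) auto
next
  case (Suc m)
  have zero: "bounded_derivs 0 I \<phi>" "bounded_derivs 0 I \<gamma>" "bounded_derivs 0 I \<psi>"
    using Suc.prems bounded_derivs_Suc by blast+
  have lower: "bounded_derivs m I \<phi>" "bounded_derivs m I \<gamma>" "bounded_derivs m I \<psi>"
    using Suc.prems bounded_derivs_mono le_SucI by blast+
  have derivs: "bounded_derivs m I (\<lambda>i. deriv (\<phi> i))" "bounded_derivs m I (\<lambda>i. deriv (\<gamma> i))"
      "bounded_derivs m I (\<lambda>i. deriv (\<psi> i))"
    using Suc.prems bounded_derivs_Suc by blast+
  have ab: "a \<ge> b + 2" using Suc.prems by simp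
  note base = bounded_derivs_0_power_quotient[OF zero le ab]
  have "bounded_derivs m I (\<lambda>i. deriv (\<lambda>w. \<gamma> i w ^ a * \<psi> i w / \<phi> i w ^ b))"
  proof (rule bounded_derivs_cong)
    show "bounded_derivs m I (\<lambda>i w. \<gamma> i w ^ (a - 1) * (of_nat a * (deriv (\<gamma> i) w * \<psi> i w)) / \<phi> i w ^ b
        + \<gamma> i w ^ a * deriv (\<psi> i) w / \<phi> i w ^ b
        + \<gamma> i w ^ a * (- of_nat b * (\<psi> i w * deriv (\<phi> i) w)) / \<phi> i w ^ (b + 1))"
      by (intro bounded_derivs_add Suc.IH bounded_derivs_mult bounded_derivs_const[OF order_refl] lower derivs)
         (use Suc.prems(4) in auto)
    fix i and w :: complex assume "i \<in> I" "w \<in> ball 0 1"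
    from DERIV_imp_deriv[OF base(2)[OF _ _ this]]
    show "\<gamma> i w ^ (a - 1) * (of_nat a * (deriv (\<gamma> i) w * \<psi> i w)) / \<phi> i w ^ b
        + \<gamma> i w ^ a * deriv (\<psi> i) w / \<phi> i w ^ b
        + \<gamma> i w ^ a * (- of_nat b * (\<psi> i w * deriv (\<phi> i) w)) / \<phi> i w ^ (b + 1)
        = deriv (\<lambda>w. \<gamma> i w ^ a * \<psi> i w / \<phi> i w ^ b) w" by simp
  qed
  with base(1) show ?case by (simp add: bounded_derivs_Suc)
qed

lemma bounded_derivs_polynomial_slices:
  assumes "p \<in> complex_polynomials"
  shows "bounded_derivs m unit_ball (\<lambda>z w. p (w *s z))"
proof -
  obtain K c where p: "p = (\<lambda>z. \<Sum>k\<in>K. c k * mi_power z k)"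
    using assms unfolding complex_polynomials_def by blast
  have coord: "bounded_derivs m unit_ball (\<lambda>(z :: complex ^ 'a) w. w * z $ i)" for i
  proof (rule bounded_derivs_linear)
    fix z :: "complex ^ 'a" assume "z \<in> unit_ball"
    then show "cmod (z $ i) \<le> 1" using Finite_Cartesian_Product.norm_nth_le[of z i] by simp
  qed
  show ?thesis
    unfolding p mi_power_def vector_smult_component
    by (rule bounded_derivs_sum, rule bounded_derivs_mult, rule bounded_derivs_const[OF order_refl],
        rule bounded_derivs_prod, rule bounded_derivs_power, rule coord)
qed

section \<open>Decay of the homogeneous parts\<close>

lemma le_of_scaled_powers:
  fixes x y :: real
  assumes "\<And>r. 0 < r \<Longrightarrow> r < 1 \<Longrightarrow> x * r ^ n \<le> y"
  shows "x \<le> y"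
proof -
  have lim: "((\<lambda>r. x * r ^ n) \<longlongrightarrow> x * 1 ^ n) (at_left (1::real))"
    by (intro tendsto_intros)
  have "eventually (\<lambda>r. r \<in> {0<..<1}) (at_left (1::real))"
    by (rule eventually_at_leftI[of 0]) auto
  then have "eventually (\<lambda>r. x * r ^ n \<le> y) (at_left (1::real))"
    by eventually_elim (use assms in auto)
  from tendsto_upperbound[OF lim this] show ?thesis by simp
qed

lemma higher_deriv_0_bound:
  fixes A :: real
  assumes hol: "h holomorphic_on ball 0 1" and A: "\<And>w. w \<in> ball 0 1 \<Longrightarrow> cmod (h w) \<le> A"
  shows "cmod ((deriv ^^ n) h 0) \<le> fact n * A"
proof -
  have *: "cmod ((deriv ^^ n) h 0) * r ^ n \<le> fact n * A" if "0 < r" "r < 1" for r :: real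
  proof -
    have "cball 0 r \<subseteq> ball (0::complex) 1" using that by auto
    then have "h holomorphic_on cball 0 r" using hol holomorphic_on_subset by blast
    then have "cmod ((deriv ^^ n) h 0) \<le> fact n * A / r ^ n"
      using that A holomorphic_on_imp_continuous_on holomorphic_on_subset[OF _ ball_subset_cball]
      by (intro Cauchy_inequality) auto
    then show ?thesis using that by (simp add: pos_le_divide_eq)
  qed
  then show ?thesis by (rule le_of_scaled_powers)
qed

lemma fact_ratio_bound:
  assumes "m' \<le> m" "m \<le> j"
  shows "fact (j - m') * (1 + real j) ^ m' \<le> (real m + 1) ^ m' * fact j"
  using assms(1)
proof (induction m')
  case (Suc m')
  define d where "d = real (j - m')"
  have d: "d > 0" "fact (j - m') = d * fact (j - Suc m')"
    using Suc.prems assms(2) by (auto simp: d_def Suc_diff_Suc fact_reduce)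
  have "d \<ge> real j - real m + 1" using Suc.prems assms(2) by (simp add: d_def)
  then have "(real m + 1) * d \<ge> (real m + 1) * (real j - real m + 1)"
    by (intro mult_left_mono) auto
  moreover have "(real m + 1) * (real j - real m + 1) - (1 + real j) = real m * (real j - real m)"
    by (simp add: algebra_simps)
  moreover have "real m * (real j - real m) \<ge> 0" using assms(2) by simp
  ultimately have 1: "1 + real j \<le> (real m + 1) * d" by linarith
  have "d * (fact (j - Suc m') * (1 + real j) ^ Suc m') = (fact (j - m') * (1 + real j) ^ m') * (1 + real j)"
    by (simp add: d(2))
  also have "\<dots> \<le> ((real m + 1) ^ m' * fact j) * ((real m + 1) * d)"
    using Suc.prems by (intro mult_mono[OF Suc.IH 1]) auto
  also have "\<dots> = d * ((real m + 1) ^ Suc m' * fact j)" by simp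
  finally show ?case using d(1) by (simp only: mult_le_cancel_left_pos)
qed simp

text \<open>
  Bounded derivatives of order \<open>m\<close> force the Taylor coefficients of the slices to decay like
  \<open>j ^ (- m)\<close>, by Cauchy's inequality for the \<open>m\<close>-th derivative.
\<close>
lemma hom_part_decay:
  assumes bd: "bounded_derivs m unit_ball (\<lambda>z w. h (w *s z))"
  obtains C where "C \<ge> 0" "\<And>j z. z \<in> unit_ball \<Longrightarrow> cmod (hom_part h j z) \<le> C / (1 + real j) ^ m"
proof -
  obtain A where A: "\<And>z w. z \<in> unit_ball \<Longrightarrow> w \<in> ball 0 1 \<Longrightarrow> cmod ((deriv ^^ m) (\<lambda>w. h (w *s z)) w) \<le> A"
    using bd unfolding bounded_derivs_def by blast
  obtain B where B: "\<And>z w. z \<in> unit_ball \<Longrightarrow> w \<in> ball 0 1 \<Longrightarrow> cmod ((deriv ^^ 0) (\<lambda>w. h (w *s z)) w) \<le> B"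
    using bd unfolding bounded_derivs_def by blast
  have A0: "A \<ge> 0" using order_trans[OF norm_ge_zero A[of 0 0]] by simp
  have B0: "B \<ge> 0" using order_trans[OF norm_ge_zero B[of 0 0]] by simp
  show ?thesis
  proof
    show "(A + B) * (real m + 1) ^ m \<ge> 0" using A0 B0 by simp
    fix j and z :: "complex ^ 'a" assume z: "z \<in> unit_ball"
    have hol: "(\<lambda>w. h (w *s z)) holomorphic_on ball 0 1"
      using bd z by (simp add: bounded_derivs_def)
    have "cmod (hom_part h j z) * (1 + real j) ^ m \<le> (A + B) * (real m + 1) ^ m"
    proof (cases "m \<le> j")
      case True
      have "cmod ((deriv ^^ (j - m)) ((deriv ^^ m) (\<lambda>w. h (w *s z))) 0) \<le> fact (j - m) * A"
        by (intro higher_deriv_0_bound holomorphic_higher_deriv hol open_ball A z)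
      then have "cmod ((deriv ^^ j) (\<lambda>w. h (w *s z)) 0) \<le> fact (j - m) * A"
        using True by (simp flip: funpow_add[THEN fun_cong, unfolded o_def])
      then have "cmod (hom_part h j z) * (1 + real j) ^ m \<le> fact (j - m) * A / fact j * (1 + real j) ^ m"
        unfolding hom_part_def norm_divide norm_fact by (intro mult_right_mono divide_right_mono) auto
      also have "\<dots> = A * (fact (j - m) * (1 + real j) ^ m) / fact j" by simp
      also have "\<dots> \<le> A * ((real m + 1) ^ m * fact j) / fact j"
        using A0 True by (intro divide_right_mono mult_left_mono fact_ratio_bound) auto
      also have "\<dots> \<le> (A + B) * (real m + 1) ^ m" using B0 by (simp add: mult_right_mono)
      finally show ?thesis .
    next
      case False
      have "cmod ((deriv ^^ j) (\<lambda>w. h (w *s z)) 0) \<le> fact j * B"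
        using B[OF z] by (intro higher_deriv_0_bound hol) auto
      then have "cmod (hom_part h j z) \<le> B"
        by (simp add: hom_part_def norm_divide pos_divide_le_eq mult.commute)
      then have "cmod (hom_part h j z) * (1 + real j) ^ m \<le> B * (real m + 1) ^ m"
        using False B0 by (intro mult_mono power_mono) auto
      also have "\<dots> \<le> (A + B) * (real m + 1) ^ m" using A0 by (simp add: mult_right_mono)
      finally show ?thesis .
    qed
    then show "cmod (hom_part h j z) \<le> (A + B) * (real m + 1) ^ m / (1 + real j) ^ m"
      by (simp add: pos_le_divide_eq)
  qed
qed

section \<open>Slices of functions smooth up to the boundary\<close>

lemma smooth_up_to_boundary_bounded:
  assumes "smooth_up_to_boundary f (ball (0::'a::euclidean_space) 1)" "set bs \<subseteq> Basis"
  shows "\<exists>C. \<forall>x\<in>ball 0 1. norm (iterated_partial bs f x) \<le> C"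
proof -
  obtain G where G: "continuous_on (closure (ball 0 1)) G" "\<And>x. x \<in> ball 0 1 \<Longrightarrow> G x = iterated_partial bs f x"
    using assms unfolding smooth_up_to_boundary_def by blast
  have "bounded (G ` cball 0 1)"
    using G(1) by (intro compact_imp_bounded compact_continuous_image) (auto simp: closure_ball)
  then obtain C where "\<And>x. x \<in> cball 0 1 \<Longrightarrow> norm (G x) \<le> C"
    unfolding bounded_iff by blast
  then have "\<forall>x\<in>ball 0 1. norm (iterated_partial bs f x) \<le> C"
    using G(2) ball_subset_cball by (metis subsetD)
  then show ?thesis by blast
qed

text \<open>
  The derivative of order \<open>l\<close> in direction \<open>z\<close> of the partial derivative of \<open>f\<close> given by \<open>bs\<close>,
  expanded in the coordinate directions. It is evaluated at \<open>x\<close>.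
\<close>
primrec iterated_directional ::
    "nat \<Rightarrow> 'a list \<Rightarrow> ('a::euclidean_space \<Rightarrow> 'b::real_normed_vector) \<Rightarrow> 'a \<Rightarrow> 'a \<Rightarrow> 'b"
  where
    "iterated_directional 0 bs f z x = iterated_partial bs f x"
  | "iterated_directional (Suc l) bs f z x = (\<Sum>b\<in>Basis. (z \<bullet> b) *\<^sub>R iterated_directional l (b # bs) f z x)"

lemma iterated_directional_bounded:
  assumes f: "smooth_up_to_boundary f (ball (0::'a::euclidean_space) 1)" and "set bs \<subseteq> Basis"
  shows "\<exists>C. \<forall>z\<in>ball 0 1. \<forall>x\<in>ball 0 1. norm (iterated_directional l bs f z x) \<le> C"
  using assms(2)
proof (induction l arbitrary: bs)
  case 0
  then show ?case using smooth_up_to_boundary_bounded[OF f] by auto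
next
  case (Suc l)
  have "\<exists>C. \<forall>z\<in>ball 0 1. \<forall>x\<in>ball 0 1. norm (iterated_directional l (b # bs) f z x) \<le> C"
    if "b \<in> Basis" for b using Suc that by simp
  then obtain C where C: "\<And>b z x. b \<in> Basis \<Longrightarrow> z \<in> ball 0 1 \<Longrightarrow> x \<in> ball 0 1 \<Longrightarrow>
      norm (iterated_directional l (b # bs) f z x) \<le> C b" by metis
  have "norm (iterated_directional (Suc l) bs f z x) \<le> (\<Sum>b\<in>Basis. C b)"
    if zx: "z \<in> ball 0 1" "x \<in> ball 0 1" for z x
    unfolding iterated_directional.simps
  proof (rule sum_norm_le)
    fix b :: 'a assume b: "b \<in> Basis"
    have "\<bar>z \<bullet> b\<bar> \<le> 1" using Basis_le_norm[OF b, of z] zx by simp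
    then have "\<bar>z \<bullet> b\<bar> * norm (iterated_directional l (b # bs) f z x) \<le> 1 * C b"
      using C[OF b zx] by (intro mult_mono) auto
    then show "norm ((z \<bullet> b) *\<^sub>R iterated_directional l (b # bs) f z x) \<le> C b" by simp
  qed
  then show ?case by blast
qed

lemma iterated_directional_derivative:
  assumes f: "smooth_up_to_boundary f (ball (0::'a::euclidean_space) 1)" and "set bs \<subseteq> Basis"
    and t: "t *\<^sub>R z \<in> ball 0 1"
  shows "((\<lambda>t. iterated_directional l bs f z (t *\<^sub>R z)) has_vector_derivative
           iterated_directional (Suc l) bs f z (t *\<^sub>R z)) (at t)"
  using assms(2)
proof (induction l arbitrary: bs)
  case 0
  define G where "G = iterated_partial bs f"
  have "G differentiable_on ball 0 1" using f 0 by (simp add: smooth_up_to_boundary_def G_def)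
  then have "G differentiable (at (t *\<^sub>R z))"
    using t at_within_open[OF t open_ball] unfolding differentiable_on_def by metis
  then have G: "(G has_derivative frechet_derivative G (at (t *\<^sub>R z))) (at (t *\<^sub>R z))"
    by (simp add: frechet_derivative_works)
  interpret L: bounded_linear "frechet_derivative G (at (t *\<^sub>R z))"
    by (rule has_derivative_bounded_linear[OF G])
  have "((\<lambda>t. t *\<^sub>R z) has_derivative (\<lambda>s. s *\<^sub>R z)) (at t)"
    by (auto intro!: derivative_eq_intros)
  from has_derivative_compose[OF this G]
  have "((\<lambda>t. G (t *\<^sub>R z)) has_vector_derivative frechet_derivative G (at (t *\<^sub>R z)) z) (at t)"
    by (simp add: has_vector_derivative_def L.scaleR)
  also have "frechet_derivative G (at (t *\<^sub>R z)) z
      = frechet_derivative G (at (t *\<^sub>R z)) (\<Sum>b\<in>Basis. (z \<bullet> b) *\<^sub>R b)"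
    by (simp add: euclidean_representation)
  also have "\<dots> = (\<Sum>b\<in>Basis. (z \<bullet> b) *\<^sub>R frechet_derivative G (at (t *\<^sub>R z)) b)"
    by (simp add: L.sum L.scaleR)
  finally show ?case by (simp add: G_def)
next
  case (Suc l)
  show ?case unfolding iterated_directional.simps(2)[of l bs] iterated_directional.simps(2)[of "Suc l" bs]
    using Suc
    by (intro has_vector_derivative_sum bounded_linear.has_vector_derivative[OF bounded_linear_scaleR_right]) auto
qed

lemma scaleR_in_unit_ball:
  fixes z :: "'a::real_normed_vector"
  assumes "\<bar>t\<bar> < 1" "z \<in> ball 0 1"
  shows "t *\<^sub>R z \<in> ball 0 1"
proof -
  have "\<bar>t\<bar> * norm z \<le> norm z" using assms by (intro mult_left_le_one_le) auto
  then show ?thesis using assms by simp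
qed

text \<open>
  At real points of the disc, the complex derivatives of a slice are its derivatives along the real
  line, and these are directional derivatives of \<open>f\<close>. This avoids showing that the real partial
  derivatives of \<open>f\<close> are themselves holomorphic.
\<close>
lemma higher_deriv_slice_real:
  fixes z :: "complex ^ 'n::finite"
  assumes f: "f \<in> A_infinity" and z: "z \<in> unit_ball" and t: "t \<in> {-1<..<1}"
  shows "(deriv ^^ l) (\<lambda>w. f (w *s z)) (of_real t) = iterated_directional l [] f z (t *\<^sub>R z)"
  using t
proof (induction l arbitrary: t)
  case 0
  have "complex_of_real t *s z = t *\<^sub>R z" 
    by (simp only: vec_eq_iff vector_smult_component vector_scaleR_component) (simp add: scaleR_conv_of_real)
  then show ?case by simp
next
  case (Suc l)
  have smooth: "smooth_up_to_boundary f unit_ball" and hf: "holomorphic_several_on f unit_ball"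
    using f by (auto simp: A_infinity_def)
  define u where "u = (\<lambda>w. f (w *s z))"
  have hol: "u holomorphic_on ball 0 1"
    unfolding u_def by (rule holomorphic_on_slice[OF hf]) (use z in \<open>auto intro: scaled_norm_less_1[of _ 1]\<close>)
  have tb: "complex_of_real t \<in> ball 0 1" using Suc.prems by auto
  have tz: "t *\<^sub>R z \<in> ball 0 1"
    using Suc.prems z by (intro scaleR_in_unit_ball) auto
  have "((deriv ^^ l) u has_field_derivative (deriv ^^ Suc l) u (of_real t)) (at (of_real t))"
    using holomorphic_derivI[OF holomorphic_higher_deriv[OF hol open_ball] open_ball tb] by simp
  from has_vector_derivative_real_field[OF this]
  have "((\<lambda>t. (deriv ^^ l) u (of_real t)) has_vector_derivative (deriv ^^ Suc l) u (of_real t)) (at t)" .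
  then have "((\<lambda>t. iterated_directional l [] f z (t *\<^sub>R z)) has_vector_derivative (deriv ^^ Suc l) u (of_real t)) (at t)"
    by (rule has_vector_derivative_transform_within_open[of _ _ _ "{-1<..<1}"])
       (use Suc in \<open>auto simp: u_def\<close>)
  from vector_derivative_unique_at[OF this iterated_directional_derivative[OF smooth _ tz]]
  show ?case by (simp add: u_def)
qed

lemma bounded_derivs_slices:
  fixes f :: "complex ^ 'n::finite \<Rightarrow> complex"
  assumes f: "f \<in> A_infinity"
  shows "bounded_derivs m unit_ball (\<lambda>z w. f (w *s z))"
  unfolding bounded_derivs_def
proof (intro conjI ballI allI impI)
  have smooth: "smooth_up_to_boundary f unit_ball" and hf: "holomorphic_several_on f unit_ball"
    using f by (auto simp: A_infinity_def)
  show hol: "(\<lambda>w. f (w *s z)) holomorphic_on ball 0 1" if "z \<in> unit_ball" for z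
    by (rule holomorphic_on_slice[OF hf]) (use that in \<open>auto intro: scaled_norm_less_1[of _ 1]\<close>)
  fix l
  obtain C where C: "\<And>z x. z \<in> unit_ball \<Longrightarrow> x \<in> unit_ball \<Longrightarrow> norm (iterated_directional l [] f z x) \<le> C"
    using iterated_directional_bounded[OF smooth, of "[]" l] by (metis empty_set empty_subsetI)
  have "cmod ((deriv ^^ l) (\<lambda>w. f (w *s z)) w) \<le> C" if z: "z \<in> unit_ball" and w: "w \<in> ball 0 1" for z w
  proof -
    \<comment> \<open>Rotating \<open>z\<close> by the argument of \<open>w\<close> moves the point \<open>w\<close> of the disc to the real axis.\<close>
    define \<zeta> where "\<zeta> = cis (Arg w)"
    define t where "t = cmod w"
    have w_eq: "w = \<zeta> * of_real t" and \<zeta>: "cmod \<zeta> = 1"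
      using rcis_cmod_Arg[of w] by (auto simp: \<zeta>_def t_def rcis_def mult.commute)
    have t: "t \<in> {-1<..<1}" using w norm_ge_zero[of w] by (simp add: t_def del: norm_ge_zero)
    have tb: "complex_of_real t \<in> ball 0 1" using t by auto
    have \<zeta>z: "\<zeta> *s z \<in> unit_ball" using z \<zeta> by (simp add: norm_vector_smult)
    have "(deriv ^^ l) (\<lambda>x. (\<lambda>w. f (w *s z)) (\<zeta> * x)) (of_real t)
        = \<zeta> ^ l * (deriv ^^ l) (\<lambda>w. f (w *s z)) (\<zeta> * of_real t)"
      by (rule higher_deriv_compose_linear[OF hol[OF z] open_ball open_ball tb])
         (use \<zeta> in \<open>simp add: norm_mult\<close>)
    then have "cmod ((deriv ^^ l) (\<lambda>w. f (w *s z)) w)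
        = cmod ((deriv ^^ l) (\<lambda>x. f (x *s (\<zeta> *s z))) (of_real t))"
      using \<zeta> by (simp add: w_eq[symmetric] norm_mult norm_power mult.commute)
    also have "\<dots> = cmod (iterated_directional l [] f (\<zeta> *s z) (t *\<^sub>R (\<zeta> *s z)))"
      by (simp only: higher_deriv_slice_real[OF f \<zeta>z t])
    also have "\<dots> \<le> C"
      using \<zeta>z t by (intro C scaleR_in_unit_ball) auto
    finally show ?thesis .
  qed
  then show "\<exists>C. \<forall>z\<in>unit_ball. \<forall>w\<in>ball 0 1. cmod ((deriv ^^ l) (\<lambda>w. f (w *s z)) w) \<le> C" by blast
qed

section \<open>Decay controls the Dirichlet norm\<close>

text \<open>
  Two halves of a crude Stirling formula.
\<close>
lemma power_le_exp_fact: "real N ^ N \<le> fact N * exp (real N)"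
proof -
  have "(\<Sum>n\<in>{N}. real N ^ n /\<^sub>R fact n) \<le> (\<Sum>n. real N ^ n /\<^sub>R fact n)"
    by (rule sum_le_suminf[OF summable_exp_generic]) auto
  then show ?thesis by (simp add: exp_def divide_simps mult.commute)
qed

lemma fact_exp_le: "fact k * exp (real k) \<le> 3 * (1 + real k) * real k ^ k"
proof -
  have *: "fact (Suc k) * exp (real (Suc k)) \<le> exp 1 * real (Suc k) ^ (Suc k + 1)" for k
  proof (induction k)
    case (Suc k)
    define x where "x = real (Suc k)"
    have x: "x > 0" by (simp add: x_def)
    have "1 + (- (1 / (x + 1))) \<le> exp (- (1 / (x + 1)))" by (rule exp_ge_add_one_self)
    moreover have "1 + (- (1 / (x + 1))) = x / (x + 1)" using x by (simp add: field_simps)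
    ultimately have "(x / (x + 1)) ^ (Suc k + 1) \<le> exp (- (1 / (x + 1))) ^ (Suc k + 1)"
      using x by (intro power_mono) auto
    also have "\<dots> = exp (real (Suc k + 1) * (- (1 / (x + 1))))" by (simp only: exp_of_nat_mult)
    also have "real (Suc k + 1) * (- (1 / (x + 1))) = -1" using x by (simp add: x_def field_simps)
    finally have "x ^ (Suc k + 1) \<le> exp (-1) * (x + 1) ^ (Suc k + 1)"
      using x by (simp add: power_divide pos_divide_le_eq del: power_Suc)
    then have "exp 1 * x ^ (Suc k + 1) \<le> exp 1 * (exp (-1) * (x + 1) ^ (Suc k + 1))"
      by (intro mult_left_mono) auto
    also have "\<dots> = (x + 1) ^ (Suc k + 1)" by (simp add: exp_minus del: power_Suc)
    finally have step: "exp 1 * x ^ (Suc k + 1) \<le> (x + 1) ^ (Suc k + 1)" .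
    have "fact (Suc (Suc k)) * exp (real (Suc (Suc k))) = (x + 1) * exp 1 * (fact (Suc k) * exp (real (Suc k)))"
    proof -
      have "real (Suc (Suc k)) = x + 1" by (simp add: x_def)
      moreover have "exp (x + 1) = exp 1 * exp x" by (simp only: exp_add mult.commute)
      ultimately have "exp (real (Suc (Suc k))) = exp 1 * exp x" "real (Suc (Suc k)) = x + 1"
        by (simp_all only:)
      then show ?thesis unfolding fact_Suc[of "Suc k"] by (simp add: x_def[symmetric] del: fact_Suc of_nat_Suc)
    qed
    also have "\<dots> \<le> (x + 1) * exp 1 * (exp 1 * x ^ (Suc k + 1))"
      using Suc x by (intro mult_left_mono) (auto simp: x_def)
    also have "\<dots> \<le> (x + 1) * exp 1 * (x + 1) ^ (Suc k + 1)"
      using step x by (intro mult_left_mono) auto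
    also have "\<dots> = exp 1 * real (Suc (Suc k)) ^ (Suc (Suc k) + 1)" by (simp add: x_def algebra_simps)
    finally show ?case .
  qed simp
  show ?thesis
  proof (cases k)
    case (Suc k')
    have "fact k * exp (real k) \<le> exp 1 * real k ^ (k + 1)" using *[of k'] Suc by simp
    also have "\<dots> = exp 1 * real k * real k ^ k" by simp
    also have "\<dots> \<le> 3 * (1 + real k) * real k ^ k"
      using exp_le by (intro mult_right_mono mult_mono) auto
    finally show ?thesis .
  qed simp
qed

text \<open>
  The multinomial distribution with probabilities \<open>k\<^sub>i / \<bar>k\<bar>\<close> gives the multi-index \<open>k\<close> a weight
  that is at least polynomially small in \<open>\<bar>k\<bar>\<close>.
\<close>
lemma multinomial_weight_bound:
  fixes k :: "'n::finite \<Rightarrow> nat"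
  shows "mi_fact k / fact (mi_abs k) \<le>
    3 ^ CARD('n) * (1 + real (mi_abs k)) ^ CARD('n) * (\<Prod>i\<in>UNIV. (real (k i) / real (mi_abs k)) ^ k i)"
proof -
  define N where "N = mi_abs k"
  have expN: "exp (real N) = (\<Prod>i\<in>UNIV. exp (real (k i)))"
    by (simp add: N_def mi_abs_def exp_sum)
  have powN: "real N ^ N = (\<Prod>i\<in>UNIV. real N ^ k i)"
    by (simp add: N_def mi_abs_def power_sum)
  have pos: "real N ^ N > 0" by (cases "N = 0") auto
  have "mi_fact k * exp (real N) = (\<Prod>i\<in>UNIV. fact (k i) * exp (real (k i)))"
    unfolding mi_fact_def expN by (simp add: prod.distrib)
  also have "\<dots> \<le> (\<Prod>i\<in>(UNIV :: 'n set). 3 * (1 + real N) * real (k i) ^ k i)"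
  proof (rule prod_mono)
    fix i :: 'n
    have "fact (k i) * exp (real (k i)) \<le> 3 * (1 + real (k i)) * real (k i) ^ k i" by (rule fact_exp_le)
    also have "\<dots> \<le> 3 * (1 + real N) * real (k i) ^ k i"
      using mi_abs_component_le[of k i] by (intro mult_right_mono) (auto simp: N_def)
    finally show "0 \<le> fact (k i) * exp (real (k i)) \<and>
        fact (k i) * exp (real (k i)) \<le> 3 * (1 + real N) * real (k i) ^ k i" by simp
  qed
  also have "\<dots> = 3 ^ CARD('n) * (1 + real N) ^ CARD('n) * (\<Prod>i\<in>UNIV. real (k i) ^ k i)"
    by (simp only: prod.distrib prod_constant power_mult_distrib)
  finally have 1: "mi_fact k * exp (real N) \<le> \<dots>" .
  have "mi_fact k * real N ^ N \<le> mi_fact k * (fact N * exp (real N))"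
    by (intro mult_left_mono power_le_exp_fact) (simp add: mi_fact_def prod_nonneg)
  also have "\<dots> = fact N * (mi_fact k * exp (real N))" by simp
  also have "\<dots> \<le> fact N * (3 ^ CARD('n) * (1 + real N) ^ CARD('n) * (\<Prod>i\<in>UNIV. real (k i) ^ k i))"
    using 1 by (intro mult_left_mono) auto
  finally have "mi_fact k / fact N \<le>
      3 ^ CARD('n) * (1 + real N) ^ CARD('n) * (\<Prod>i\<in>UNIV. real (k i) ^ k i) / real N ^ N"
    using pos by (simp add: divide_simps mult_ac)
  also have "\<dots> = 3 ^ CARD('n) * (1 + real N) ^ CARD('n) * (\<Prod>i\<in>UNIV. (real (k i) / real N) ^ k i)"
    unfolding powN by (simp add: power_divide prod_dividef)
  finally show ?thesis by (simp add: N_def)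
qed

text \<open>
  The radii \<open>r i = sqrt (k\<^sub>i / \<bar>k\<bar>)\<close> maximise the monomial \<open>r ^ k\<close> on the unit sphere. For
  \<open>k = 0\<close> all radii are \<open>0\<close>, and the product is \<open>1\<close> since \<open>0 ^ 0 = 1\<close>.
\<close>
lemma coeff_sq_bound:
  fixes h :: "complex ^ 'n::finite \<Rightarrow> complex"
  assumes h: "holomorphic_several_on h unit_ball"
    and T: "\<And>z. z \<in> unit_ball \<Longrightarrow> cmod (hom_part h (mi_abs k) z) \<le> T"
  shows "(cmod (power_series_coeff h k))\<^sup>2 * (\<Prod>i\<in>UNIV. (real (k i) / real (mi_abs k)) ^ k i) \<le> T\<^sup>2"
proof -
  define N where "N = mi_abs k"
  have closed: "cmod (hom_part h N z) \<le> T" if z: "norm z \<le> 1" for z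
  proof (rule le_of_scaled_powers)
    fix r :: real assume r: "0 < r" "r < 1"
    have "r * norm z \<le> r" using r z by (intro mult_left_le) auto
    then have "r * norm z < 1" using r by linarith
    then have "of_real r *s z \<in> unit_ball" using r by (simp add: norm_vector_smult)
    from T[OF this] show "cmod (hom_part h N z) * r ^ N \<le> T"
      using r by (simp add: hom_part_smult[OF h] norm_mult norm_power N_def mult.commute)
  qed
  define r where "r = (\<lambda>i. sqrt (real (k i) / real N))"
  have "cmod (power_series_coeff h k) * (\<Prod>i\<in>UNIV. r i ^ k i) \<le> T"
  proof (rule torus_coeff_bound[where K="{l. mi_abs l = N}"])
    fix z :: "complex ^ 'n" assume z: "\<And>i. cmod (z $ i) = r i"
    have "(\<Sum>i\<in>UNIV. (r i)\<^sup>2) = (\<Sum>i\<in>UNIV. real (k i)) / real N"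
      by (simp add: r_def sum_divide_distrib)
    also have "\<dots> \<le> 1" by (simp add: N_def mi_abs_def)
    finally have "norm z \<le> 1" by (simp add: norm_vec_def L2_set_def z)
    from closed[OF this] show "cmod (\<Sum>l | mi_abs l = N. power_series_coeff h l * mi_power z l) \<le> T"
      by (simp add: hom_part_eq_power_series_coeff[OF h])
  qed (auto simp: finite_mi_abs_eq N_def r_def)
  then have "(cmod (power_series_coeff h k) * (\<Prod>i\<in>UNIV. r i ^ k i))\<^sup>2 \<le> T\<^sup>2"
    by (intro power_mono) (auto intro!: mult_nonneg_nonneg prod_nonneg simp: r_def)
  moreover have "(\<Prod>i\<in>UNIV. r i ^ k i)\<^sup>2 = (\<Prod>i\<in>UNIV. (real (k i) / real N) ^ k i)"
  proof -
    have "(r i ^ k i)\<^sup>2 = ((r i)\<^sup>2) ^ k i" for i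
      by (simp only: power_mult[symmetric] mult.commute)
    then show ?thesis by (simp add: r_def prod_power_distrib)
  qed
  ultimately show ?thesis by (simp add: power_mult_distrib N_def)
qed

text \<open>
  The weight of the coefficient \<open>k\<close> exceeds \<open>\<Prod>i. (k\<^sub>i / \<bar>k\<bar>) ^ k\<^sub>i\<close> at most by a factor polynomial
  in \<open>1 + \<bar>k\<bar>\<close>, of degree \<open>A + n\<close> where \<open>A \<ge> \<bar>\<alpha>\<bar>\<close>. Sufficient decay of the homogeneous parts
  absorbs this factor and leaves a summable product.
\<close>
lemma dirichlet_term_bound:
  fixes h :: "complex ^ 'n::finite \<Rightarrow> complex" and \<alpha> :: real
  defines "A \<equiv> nat \<lceil>\<bar>\<alpha>\<bar>\<rceil>"
  assumes h: "holomorphic_several_on h unit_ball" and C: "C \<ge> 0"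
    and decay: "\<And>j z. z \<in> unit_ball \<Longrightarrow> cmod (hom_part h j z) \<le> C / (1 + real j) ^ (A + 3 * CARD('n))"
  shows "dirichlet_term \<alpha> h k \<le>
    C\<^sup>2 * (real CARD('n) ^ A * 3 ^ CARD('n)) * (\<Prod>i\<in>UNIV. 1 / (1 + real (k i)) ^ 2)"
proof -
  define n where "n = CARD('n)"
  define N where "N = mi_abs k"
  define X where "X = 1 + real N"
  define P where "P = (\<Prod>i\<in>UNIV. (real (k i) / real N) ^ k i)"
  define c where "c = (cmod (power_series_coeff h k))\<^sup>2"
  have n: "n \<ge> 1" by (simp add: n_def Suc_leI)
  have X: "X \<ge> 1" by (simp add: X_def)
  have P: "P \<ge> 0" by (auto simp: P_def intro!: prod_nonneg)
  have c: "c \<ge> 0" by (simp add: c_def)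
  have cP: "c * P \<le> (C / X ^ (A + 3 * n))\<^sup>2"
    using coeff_sq_bound[OF h decay[where j="mi_abs k"]] by (simp add: c_def P_def N_def X_def n_def)
  have w1: "real (n + N) powr \<alpha> \<le> real n ^ A * X ^ A"
  proof -
    have "real (n + N) powr \<alpha> \<le> real (n + N) powr real A"
      using n by (intro powr_mono) (simp_all add: A_def, linarith)
    also have "\<dots> = real (n + N) ^ A" using n by (simp add: powr_realpow)
    also have "\<dots> \<le> (real n * X) ^ A"
    proof (rule power_mono)
      have "real N \<le> real n * real N" using n by (simp add: mult_le_cancel_right1)
      then show "real (n + N) \<le> real n * X" by (simp add: X_def algebra_simps)
    qed simp
    finally show ?thesis by (simp add: power_mult_distrib)
  qed
  have w2: "fact (n - 1) * mi_fact k / fact (n - 1 + N) \<le> 3 ^ n * X ^ n * P"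
  proof -
    have "fact (n - 1) * fact N \<le> (fact (n - 1 + N) :: nat)"
      by (rule dvd_imp_le[OF fact_fact_dvd_fact]) simp
    then have "real (fact (n - 1) * fact N) \<le> real (fact (n - 1 + N))" by (rule of_nat_mono)
    then have f: "fact (n - 1) * fact N \<le> (fact (n - 1 + N) :: real)" by simp
    have m0: "mi_fact k \<ge> 0" by (simp add: mi_fact_def prod_nonneg)
    have "fact (n - 1) * mi_fact k / fact (n - 1 + N) \<le> mi_fact k / fact N"
      using mult_left_mono[OF f m0] by (simp add: divide_simps mult_ac)
    also have "\<dots> \<le> 3 ^ n * X ^ n * P"
      using multinomial_weight_bound[of k] by (simp add: n_def N_def X_def P_def)
    finally show ?thesis .
  qed
  have "dirichlet_term \<alpha> h k = real (n + N) powr \<alpha> * (fact (n - 1) * mi_fact k / fact (n - 1 + N)) * c"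
    by (simp add: dirichlet_term_def n_def N_def c_def)
  also have "\<dots> \<le> (real n ^ A * X ^ A) * (3 ^ n * X ^ n * P) * c"
    using w1 w2 c X by (intro mult_right_mono mult_mono)
      (auto simp: mi_fact_def intro!: prod_nonneg mult_nonneg_nonneg divide_nonneg_nonneg)
  also have "\<dots> = (real n ^ A * X ^ A) * (3 ^ n * X ^ n) * (c * P)" by simp
  also have "\<dots> \<le> (real n ^ A * X ^ A) * (3 ^ n * X ^ n) * (C / X ^ (A + 3 * n))\<^sup>2"
    using cP X by (intro mult_left_mono) auto
  also have "\<dots> = C\<^sup>2 * (real n ^ A * 3 ^ n) * (X ^ (A + n) / X ^ (2 * (A + 3 * n)))"
    by (simp add: power_divide power_mult power_mult_distrib power_add power2_eq_square mult_ac)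
  also have "\<dots> \<le> C\<^sup>2 * (real n ^ A * 3 ^ n) * (1 / X ^ (2 * n))"
  proof (rule mult_left_mono)
    have "X ^ (A + n) * X ^ (2 * n) \<le> X ^ (2 * (A + 3 * n))"
      unfolding power_add[symmetric] by (rule power_increasing) (use X in auto)
    then show "X ^ (A + n) / X ^ (2 * (A + 3 * n)) \<le> 1 / X ^ (2 * n)"
      using X by (simp add: divide_simps)
  qed simp
  also have "\<dots> \<le> C\<^sup>2 * (real n ^ A * 3 ^ n) * (\<Prod>i\<in>UNIV. 1 / (1 + real (k i)) ^ 2)"
  proof (rule mult_left_mono)
    have "1 / X ^ (2 * n) = (\<Prod>i\<in>(UNIV :: 'n set). 1 / X ^ 2)"
      by (simp add: n_def power_mult power_divide)
    also have "\<dots> \<le> (\<Prod>i\<in>UNIV. 1 / (1 + real (k i)) ^ 2)"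
      using mi_abs_component_le[of k] X
      by (intro prod_mono) (auto simp: X_def N_def add_pos_nonneg intro!: divide_left_mono power_mono)
    finally show "1 / X ^ (2 * n) \<le> (\<Prod>i\<in>UNIV. 1 / (1 + real (k i)) ^ 2)" .
  qed simp
  finally show ?thesis by (simp add: n_def)
qed

lemma dirichlet_term_nonneg: "dirichlet_term \<alpha> f k \<ge> 0"
  by (simp add: dirichlet_term_def mi_fact_def prod_nonneg)

lemma dirichlet_norm_bound_of_decay:
  fixes \<alpha> :: real
  obtains m K where
    "\<And>(h :: complex ^ 'n::finite \<Rightarrow> complex) C. holomorphic_several_on h unit_ball \<Longrightarrow> C \<ge> 0 \<Longrightarrow>
      (\<And>j z. z \<in> unit_ball \<Longrightarrow> cmod (hom_part h j z) \<le> C / (1 + real j) ^ m) \<Longrightarrow>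
      h \<in> dirichlet_space \<alpha> \<and> dirichlet_norm \<alpha> h \<le> K * C"
proof -
  define A where "A = nat \<lceil>\<bar>\<alpha>\<bar>\<rceil>"
  define K0 where "K0 = real CARD('n) ^ A * 3 ^ CARD('n)"
  define v where "v = (\<lambda>k :: 'n \<Rightarrow> nat. \<Prod>i\<in>UNIV. 1 / (1 + real (k i)) ^ 2)"
  have "summable (\<lambda>l. 1 / (1 + real l) ^ 2)"
    using inverse_squares_sums by (simp add: sums_iff add.commute)
  then have v: "v summable_on UNIV"
    unfolding v_def by (intro summable_on_multiindex_prod) auto
  show ?thesis
  proof
    fix h :: "complex ^ 'n \<Rightarrow> complex" and C :: real
    assume h: "holomorphic_several_on h unit_ball" and C: "C \<ge> 0"
      and decay: "\<And>j z. z \<in> unit_ball \<Longrightarrow> cmod (hom_part h j z) \<le> C / (1 + real j) ^ (A + 3 * CARD('n))"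
    have term_le: "dirichlet_term \<alpha> h k \<le> C\<^sup>2 * K0 * v k" for k
      using dirichlet_term_bound[OF h C, of \<alpha> k] decay by (simp add: A_def K0_def v_def)
    have sv: "(\<lambda>k. C\<^sup>2 * K0 * v k) summable_on UNIV" by (intro summable_on_cmult_right v)
    have s: "dirichlet_term \<alpha> h summable_on UNIV"
      by (rule summable_on_comparison_test[OF sv]) (auto simp: term_le dirichlet_term_nonneg)
    have "(\<Sum>\<^sub>\<infinity>k. dirichlet_term \<alpha> h k) \<le> (\<Sum>\<^sub>\<infinity>k. C\<^sup>2 * K0 * v k)"
      by (rule infsum_mono[OF s sv term_le])
    also have "\<dots> = C\<^sup>2 * (K0 * (\<Sum>\<^sub>\<infinity>k. v k))"
      by (subst infsum_cmult_right) (simp_all add: v)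
    finally have "dirichlet_norm \<alpha> h \<le> sqrt (C\<^sup>2 * (K0 * (\<Sum>\<^sub>\<infinity>k. v k)))"
      unfolding dirichlet_norm_def by (rule real_sqrt_le_mono)
    also have "\<dots> = sqrt (K0 * (\<Sum>\<^sub>\<infinity>k. v k)) * C"
      using C by (simp add: real_sqrt_mult)
    finally show "h \<in> dirichlet_space \<alpha> \<and> dirichlet_norm \<alpha> h \<le> sqrt (K0 * (\<Sum>\<^sub>\<infinity>k. v k)) * C"
      using h s by (simp add: dirichlet_space_def)
  qed
qed

section \<open>Approximation by polynomial multiples\<close>

lemma hom_part_cong:
  fixes u v :: "complex ^ 'n::finite \<Rightarrow> complex"
  assumes "\<And>x. x \<in> unit_ball \<Longrightarrow> u x = v x"
  shows "hom_part u j z = hom_part v j z"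
proof -
  obtain r where r: "r > 0" "\<And>w. w \<in> ball 0 r \<Longrightarrow> cmod w * norm z < 1"
    using slice_radius by blast
  have "eventually (\<lambda>w. w \<in> ball 0 r) (nhds (0::complex))"
    using r(1) by (intro eventually_nhds_in_open) auto
  then have "eventually (\<lambda>w. u (w *s z) = v (w *s z)) (nhds (0::complex))"
    by eventually_elim (use r(2) in \<open>auto intro!: assms simp: norm_vector_smult\<close>)
  then show ?thesis unfolding hom_part_def by (simp add: higher_deriv_cong_ev)
qed

lemma hom_part_mult:
  fixes u v :: "complex ^ 'n::finite \<Rightarrow> complex"
  assumes u: "holomorphic_several_on u unit_ball" and v: "holomorphic_several_on v unit_ball"
  shows "hom_part (\<lambda>z. u z * v z) j z = (\<Sum>i\<le>j. hom_part u i z * hom_part v (j - i) z)"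
proof -
  obtain r where r: "r > 0" "\<And>w. w \<in> ball 0 r \<Longrightarrow> cmod w * norm z < 1"
    using slice_radius by blast
  have "(deriv ^^ j) (\<lambda>w. u (w *s z) * v (w *s z)) 0 = (\<Sum>i=0..j. of_nat (j choose i) *
     (deriv ^^ i) (\<lambda>w. u (w *s z)) 0 * (deriv ^^ (j - i)) (\<lambda>w. v (w *s z)) 0)"
    by (rule higher_deriv_mult[where S="ball 0 r"])
       (use r in \<open>auto intro!: holomorphic_on_slice[OF u] holomorphic_on_slice[OF v]\<close>)
  also have "\<dots> = (\<Sum>i\<le>j. fact j * (hom_part u i z * hom_part v (j - i) z))"
    by (rule sum.cong) (auto simp: hom_part_def binomial_fact)
  also have "\<dots> = fact j * (\<Sum>i\<le>j. hom_part u i z * hom_part v (j - i) z)"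
    by (simp only: sum_distrib_left)
  finally have "(deriv ^^ j) (\<lambda>w. u (w *s z) * v (w *s z)) 0 = \<dots>" .
  then show ?thesis unfolding hom_part_def[of "\<lambda>z. u z * v z"] by simp
qed

lemma hom_part_taylor_remainder:
  fixes Q :: "complex ^ 'n::finite \<Rightarrow> complex"
  assumes Q: "holomorphic_several_on Q unit_ball" and z: "z \<in> unit_ball"
  shows "hom_part (\<lambda>z. Q z - (\<Sum>l<J. hom_part Q l z)) j z = (if j < J then 0 else hom_part Q j z)"
proof (rule hom_part_unique[of 1])
  fix w :: complex assume w: "w \<in> ball 0 1"
  then have "w *s z \<in> unit_ball"
    using z by (auto simp: norm_vector_smult intro: scaled_norm_less_1[of _ 1])
  from hom_part_sums[OF Q this]
  have "(\<lambda>l. hom_part Q l (w *s z)) sums Q (w *s z)" .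
  moreover have "(\<lambda>l. if l \<in> {..<J} then hom_part Q l (w *s z) else 0) sums (\<Sum>l<J. hom_part Q l (w *s z))"
    by (rule sums_If_finite_set) simp
  ultimately have "(\<lambda>l. hom_part Q l (w *s z) - (if l \<in> {..<J} then hom_part Q l (w *s z) else 0))
      sums (Q (w *s z) - (\<Sum>l<J. hom_part Q l (w *s z)))"
    by (rule sums_diff)
  moreover have "hom_part Q l (w *s z) - (if l \<in> {..<J} then hom_part Q l (w *s z) else 0)
      = (if l < J then 0 else hom_part Q l z) * w ^ l" for l
    by (simp add: hom_part_smult[OF Q])
  ultimately show "(\<lambda>l. (if l < J then 0 else hom_part Q l z) * w ^ l)
      sums (Q (w *s z) - (\<Sum>l<J. hom_part Q l (w *s z)))" by simp
qed simp

text \<open>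
  At the zeros of \<open>f\<close>, where the quotient is \<open>0\<close> by convention, it is \<open>O(\<bar>f\<bar>\<^sup>2)\<close> and so has
  derivative zero.
\<close>
lemma power_quotient_holomorphic_several_on:
  fixes f g p :: "complex ^ 'n::finite \<Rightarrow> complex"
  assumes f: "holomorphic_several_on f unit_ball" and g: "holomorphic_several_on g unit_ball"
    and p: "holomorphic_several_on p unit_ball"
    and le: "\<And>z. z \<in> unit_ball \<Longrightarrow> cmod (g z) \<le> cmod (f z)" and N: "N \<ge> 3"
  shows "holomorphic_several_on (\<lambda>z. g z ^ N * p z / f z) unit_ball"
  unfolding holomorphic_several_on_def
proof
  fix z :: "complex ^ 'n" assume z: "z \<in> unit_ball"
  from holomorphic_several_onD[OF f z] obtain L where
    L: "(f has_derivative L) (at z)" "\<And>c v. L (c *s v) = c * L v" by blast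
  show "\<exists>L. ((\<lambda>z. g z ^ N * p z / f z) has_derivative L) (at z) \<and> (\<forall>c v. L (c *s v) = c * L v)"
  proof (cases "f z = 0")
    case False
    have "holomorphic_several_on (\<lambda>z. g z ^ N * p z) unit_ball"
      by (intro holomorphic_several_on_mult holomorphic_several_on_power g p)
    from holomorphic_several_onD[OF this z] obtain M where
      M: "((\<lambda>z. g z ^ N * p z) has_derivative M) (at z)" "\<And>c v. M (c *s v) = c * M v" by blast
    from has_derivative_divide'[OF M(1) L(1) False] show ?thesis
      by (intro exI conjI) (auto simp: L(2) M(2) algebra_simps diff_divide_distrib)
  next
    case True
    obtain r where r: "norm z < r" "r < 1" using z dense by auto
    obtain A where A: "A \<ge> 0" "\<And>z. norm z \<le> r \<Longrightarrow> cmod (f z) \<le> A"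
      using bounded_on_compact_ball[OF f r(2)] by blast
    obtain B where B: "B \<ge> 0" "\<And>z. norm z \<le> r \<Longrightarrow> cmod (p z) \<le> B"
      using bounded_on_compact_ball[OF p r(2)] by blast
    have "((\<lambda>z. g z ^ N * p z / f z) has_derivative (\<lambda>_. 0)) (at z)"
    proof (rule has_derivative_zero_of_square_bound[OF L(1) True])
      show "open (ball (0 :: complex ^ 'n) r)" by simp
      show "0 \<le> B * A ^ (N - 3)" using A B by simp
      fix x :: "complex ^ 'n" assume x: "x \<in> ball 0 r"
      then have xb: "x \<in> unit_ball" "norm x \<le> r" using r by auto
      have "cmod (g x ^ N * p x / f x ^ 1) \<le> cmod (p x) * cmod (f x) ^ (N - 1)"
        using N by (intro power_quotient_bound le xb) auto
      also have "N - 1 = (N - 3) + 2" using N by simp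
      also have "cmod (p x) * cmod (f x) ^ ((N - 3) + 2) = cmod (p x) * cmod (f x) ^ (N - 3) * cmod (f x)^2"
        by (simp only: power_add mult.assoc)
      also have "\<dots> \<le> B * A ^ (N - 3) * cmod (f x)^2"
        using A B xb by (intro mult_right_mono mult_mono power_mono) auto
      finally show "cmod (g x ^ N * p x / f x) \<le> B * A ^ (N - 3) * cmod (f x)^2" by simp
    qed (use r True in auto)
    then show ?thesis by (intro exI[of _ "\<lambda>_. 0"]) simp
  qed
qed

text \<open>
  A substitute for the triangle inequality, from \<open>(x + y)\<^sup>2 \<le> 2 x\<^sup>2 + 2 y\<^sup>2\<close> applied termwise.
\<close>
lemma dirichlet_space_combination:
  fixes u v w :: "complex ^ 'n::finite \<Rightarrow> complex"
  assumes u: "u \<in> dirichlet_space \<alpha>" and v: "v \<in> dirichlet_space \<alpha>"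
    and w: "holomorphic_several_on w unit_ball"
    and le: "\<And>k. cmod (power_series_coeff w k) \<le> cmod (power_series_coeff u k) + cmod (power_series_coeff v k)"
  shows "w \<in> dirichlet_space \<alpha>"
    and "(dirichlet_norm \<alpha> w)\<^sup>2 \<le> 2 * (dirichlet_norm \<alpha> u)\<^sup>2 + 2 * (dirichlet_norm \<alpha> v)\<^sup>2"
proof -
  have term_le: "dirichlet_term \<alpha> w k \<le> 2 * dirichlet_term \<alpha> u k + 2 * dirichlet_term \<alpha> v k" for k
  proof -
    define c where "c = real (CARD('n) + mi_abs k) powr \<alpha> *
      (fact (CARD('n) - 1) * mi_fact k / fact (CARD('n) - 1 + mi_abs k))"
    have c: "c \<ge> 0" by (simp add: c_def mi_fact_def prod_nonneg)
    define x where "x = cmod (power_series_coeff u k)"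
    define y where "y = cmod (power_series_coeff v k)"
    have "(cmod (power_series_coeff w k))\<^sup>2 \<le> (x + y)\<^sup>2"
      using le[of k] by (intro power_mono) (auto simp: x_def y_def)
    also have "\<dots> \<le> 2 * x\<^sup>2 + 2 * y\<^sup>2"
      using zero_le_power2[of "x - y"] by (simp add: power2_eq_square algebra_simps)
    finally have "c * (cmod (power_series_coeff w k))\<^sup>2 \<le> c * (2 * x\<^sup>2 + 2 * y\<^sup>2)"
      using c by (rule mult_left_mono)
    moreover have "dirichlet_term \<alpha> h k = c * (cmod (power_series_coeff h k))\<^sup>2" for h :: "complex ^ 'n \<Rightarrow> complex"
      by (simp add: dirichlet_term_def c_def)
    ultimately show ?thesis by (simp add: x_def y_def algebra_simps)
  qed
  have su: "dirichlet_term \<alpha> u summable_on UNIV" and sv: "dirichlet_term \<alpha> v summable_on UNIV"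
    using u v by (auto simp: dirichlet_space_def)
  have s: "(\<lambda>k. 2 * dirichlet_term \<alpha> u k + 2 * dirichlet_term \<alpha> v k) summable_on UNIV"
    by (intro summable_on_add summable_on_cmult_right su sv)
  have sw: "dirichlet_term \<alpha> w summable_on UNIV"
    by (rule summable_on_comparison_test[OF s]) (auto simp: term_le dirichlet_term_nonneg)
  then show "w \<in> dirichlet_space \<alpha>" using w by (simp add: dirichlet_space_def)
  have norm_sq: "(dirichlet_norm \<alpha> h)\<^sup>2 = (\<Sum>\<^sub>\<infinity>k. dirichlet_term \<alpha> h k)" for h :: "complex ^ 'n \<Rightarrow> complex"
    by (simp add: dirichlet_norm_def infsum_nonneg dirichlet_term_nonneg)
  have "(\<Sum>\<^sub>\<infinity>k. dirichlet_term \<alpha> w k) \<le> (\<Sum>\<^sub>\<infinity>k. 2 * dirichlet_term \<alpha> u k + 2 * dirichlet_term \<alpha> v k)"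
    by (rule infsum_mono[OF sw s term_le])
  also have "\<dots> = 2 * (\<Sum>\<^sub>\<infinity>k. dirichlet_term \<alpha> u k) + 2 * (\<Sum>\<^sub>\<infinity>k. dirichlet_term \<alpha> v k)"
    by (simp add: infsum_add infsum_cmult_right summable_on_cmult_right su sv)
  finally show "(dirichlet_norm \<alpha> w)\<^sup>2 \<le> 2 * (dirichlet_norm \<alpha> u)\<^sup>2 + 2 * (dirichlet_norm \<alpha> v)\<^sup>2"
    by (simp only: norm_sq)
qed

lemma dirichlet_space_add:
  fixes u v :: "complex ^ 'n::finite \<Rightarrow> complex"
  assumes u: "u \<in> dirichlet_space \<alpha>" and v: "v \<in> dirichlet_space \<alpha>"
  shows "(\<lambda>z. u z + v z) \<in> dirichlet_space \<alpha>"
    and "(dirichlet_norm \<alpha> (\<lambda>z. u z + v z))\<^sup>2 \<le> 2 * (dirichlet_norm \<alpha> u)\<^sup>2 + 2 * (dirichlet_norm \<alpha> v)\<^sup>2"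
proof -
  have hol: "holomorphic_several_on u unit_ball" "holomorphic_several_on v unit_ball"
    using u v by (auto simp: dirichlet_space_def)
  note * = dirichlet_space_combination[OF u v holomorphic_several_on_add[OF hol]]
  show "(\<lambda>z. u z + v z) \<in> dirichlet_space \<alpha>"
    by (rule *(1)) (simp add: power_series_coeff_add[OF hol] norm_triangle_ineq)
  show "(dirichlet_norm \<alpha> (\<lambda>z. u z + v z))\<^sup>2 \<le> 2 * (dirichlet_norm \<alpha> u)\<^sup>2 + 2 * (dirichlet_norm \<alpha> v)\<^sup>2"
    by (rule *(2)) (simp add: power_series_coeff_add[OF hol] norm_triangle_ineq)
qed

lemma dirichlet_space_diff:
  fixes u v :: "complex ^ 'n::finite \<Rightarrow> complex"
  assumes u: "u \<in> dirichlet_space \<alpha>" and v: "v \<in> dirichlet_space \<alpha>"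
  shows "(\<lambda>z. u z - v z) \<in> dirichlet_space \<alpha>"
proof -
  have hol: "holomorphic_several_on u unit_ball" "holomorphic_several_on v unit_ball"
    using u v by (auto simp: dirichlet_space_def)
  show ?thesis
    by (rule dirichlet_space_combination(1)[OF u v holomorphic_several_on_diff[OF hol]])
       (simp add: power_series_coeff_diff[OF hol] norm_triangle_ineq4)
qed

lemma span_polynomial_multiples:
  fixes h :: "complex ^ 'n::finite \<Rightarrow> complex"
  shows "module.span (\<lambda>c u z. c * u z) {(\<lambda>z. p z * h z) | p. p \<in> complex_polynomials}
    = {(\<lambda>z. p z * h z) | p. p \<in> complex_polynomials}" (is "_ = ?S")
proof -
  interpret module "\<lambda>c (u :: complex ^ 'n \<Rightarrow> complex) z. c * u z"
    by unfold_locales (auto simp: fun_eq_iff algebra_simps)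
  have "subspace ?S"
  proof (rule subspaceI)
    show "0 \<in> ?S"
      using complex_polynomials_const[of 0] by (force simp: zero_fun_def)
    fix u v assume "u \<in> ?S" "v \<in> ?S"
    then obtain p q where "p \<in> complex_polynomials" "q \<in> complex_polynomials"
      "u = (\<lambda>z. p z * h z)" "v = (\<lambda>z. q z * h z)" by blast
    then show "u + v \<in> ?S"
      by (auto intro!: exI[of _ "\<lambda>z. p z + q z"] complex_polynomials_add simp: fun_eq_iff algebra_simps)
  next
    fix c and u assume "u \<in> ?S"
    then obtain p where "p \<in> complex_polynomials" "u = (\<lambda>z. p z * h z)" by blast
    then show "(\<lambda>z. c * u z) \<in> ?S"
      by (auto intro!: exI[of _ "\<lambda>z. c * p z"] complex_polynomials_mult complex_polynomials_const
          simp: fun_eq_iff)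
  qed
  then show ?thesis by (intro antisym span_minimal span_superset order_refl)
qed

text \<open>
  One power of the decay is spent on the factor \<open>1 / (1 + J)\<close>, which makes the remainder small. The
  power \<open>m + 1\<close> leaves room for the \<open>1 + j\<close> terms of the convolution of degree \<open>j = i + l\<close>.
\<close>
lemma convolution_term_bound:
  fixes a b :: real
  assumes ab: "0 \<le> a" "a \<le> C / (1 + real i) ^ (m + 2)" "0 \<le> b" "b \<le> D / (1 + real l) ^ (m + 2)"
    and C: "C \<ge> 0" "D \<ge> 0" and J: "J \<le> l"
  shows "a * b \<le> C * D / (1 + real J) / (1 + real (i + l)) ^ (m + 1)"
proof -
  define x where "x = (1 + real i) * (1 + real l)"
  have x1: "x \<ge> 1 + real (i + l)" by (simp add: x_def algebra_simps)
  have x2: "x \<ge> 1 + real J"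
  proof -
    have "1 * (1 + real J) \<le> (1 + real i) * (1 + real l)" using J by (intro mult_mono) auto
    then show ?thesis by (simp add: x_def)
  qed
  have "a * b \<le> C / (1 + real i) ^ (m + 2) * (D / (1 + real l) ^ (m + 2))"
    using ab C by (intro mult_mono) auto
  also have "\<dots> = C * D / (x * x ^ (m + 1))"
    by (simp add: x_def power_mult_distrib mult_ac)
  also have "\<dots> \<le> C * D / ((1 + real J) * (1 + real (i + l)) ^ (m + 1))"
  proof (rule divide_left_mono)
    have pos: "0 < 1 + real J" "0 < 1 + real (i + l)" by (auto intro: add_pos_nonneg)
    show "(1 + real J) * (1 + real (i + l)) ^ (m + 1) \<le> x * x ^ (m + 1)"
      using x1 x2 pos by (intro mult_mono power_mono) auto
    have "x > 0" using x1 pos by linarith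
    then show "0 < x * x ^ (m + 1) * ((1 + real J) * (1 + real (i + l)) ^ (m + 1))"
      using pos by (intro mult_pos_pos zero_less_power)
  qed (use C in simp)
  finally show ?thesis by (simp add: mult_ac)
qed

text \<open>
  With \<open>Q = p g ^ (m + 5) / f\<close> one has \<open>p g ^ (m + 5) = f Q\<close>, and the Taylor polynomials \<open>q\<close> of \<open>Q\<close>
  satisfy \<open>f q \<rightarrow> f Q\<close> in the Dirichlet norm. The exponent is what the quotient estimate needs for \<open>m + 2\<close>
  bounded derivatives: two more than the decay \<open>m\<close> required of \<open>f (Q - q)\<close>.
\<close>
lemma polynomial_multiple_approximation:
  fixes f g p :: "complex ^ 'n::finite \<Rightarrow> complex"
  assumes f: "f \<in> A_infinity" and g: "g \<in> A_infinity" and p: "p \<in> complex_polynomials"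
    and le: "\<And>z. z \<in> unit_ball \<Longrightarrow> cmod (g z) \<le> cmod (f z)"
    and norm_bound: "\<And>(h :: complex ^ 'n \<Rightarrow> complex) C. holomorphic_several_on h unit_ball \<Longrightarrow> C \<ge> 0 \<Longrightarrow>
      (\<And>j z. z \<in> unit_ball \<Longrightarrow> cmod (hom_part h j z) \<le> C / (1 + real j) ^ m) \<Longrightarrow>
      h \<in> dirichlet_space \<alpha> \<and> dirichlet_norm \<alpha> h \<le> K * C"
    and \<epsilon>: "\<epsilon> > 0"
  shows "\<exists>q \<in> complex_polynomials. (\<lambda>z. p z * g z ^ (m + 5) - q z * f z) \<in> dirichlet_space \<alpha> \<and>
    dirichlet_norm \<alpha> (\<lambda>z. p z * g z ^ (m + 5) - q z * f z) < \<epsilon>"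
proof -
  have hf: "holomorphic_several_on f unit_ball" and hg: "holomorphic_several_on g unit_ball"
    using f g by (auto simp: A_infinity_def)
  have hp: "holomorphic_several_on p unit_ball" by (rule holomorphic_several_on_polynomial[OF p])
  define Q where "Q = (\<lambda>z. g z ^ (m + 5) * p z / f z)"
  have hQ: "holomorphic_several_on Q unit_ball"
    unfolding Q_def by (rule power_quotient_holomorphic_several_on[OF hf hg hp le]) auto
  have "bounded_derivs (m + 2) unit_ball (\<lambda>z w. g (w *s z) ^ (m + 5) * p (w *s z) / f (w *s z) ^ 1)"
  proof (rule bounded_derivs_power_quotient[OF bounded_derivs_slices[OF f] bounded_derivs_slices[OF g]
        bounded_derivs_polynomial_slices[OF p]], rule le)
    fix z :: "complex ^ 'n" and w :: complex assume "z \<in> unit_ball" "w \<in> ball 0 1"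
    then show "w *s z \<in> unit_ball"
      by (auto simp: norm_vector_smult intro: scaled_norm_less_1[of _ 1])
  qed simp
  then have "bounded_derivs (m + 2) unit_ball (\<lambda>z w. Q (w *s z))" by (simp add: Q_def)
  from hom_part_decay[OF this] obtain D where
    D: "D \<ge> 0" "\<And>j z. z \<in> unit_ball \<Longrightarrow> cmod (hom_part Q j z) \<le> D / (1 + real j) ^ (m + 2)" by blast
  from hom_part_decay[OF bounded_derivs_slices[OF f]] obtain C where
    C: "C \<ge> 0" "\<And>j z. z \<in> unit_ball \<Longrightarrow> cmod (hom_part f j z) \<le> C / (1 + real j) ^ (m + 2)" by blast
  obtain J :: nat where J: "K * (C * D) / \<epsilon> < real J"
    using reals_Archimedean2 by blast
  define q where "q = (\<lambda>z. \<Sum>l<J. hom_part Q l z)"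
  have q: "q \<in> complex_polynomials"
    unfolding q_def by (intro complex_polynomials_sum hom_part_polynomial hQ)
  have hq: "holomorphic_several_on q unit_ball" by (rule holomorphic_several_on_polynomial[OF q])
  define h where "h = (\<lambda>z. p z * g z ^ (m + 5) - q z * f z)"
  have hh: "holomorphic_several_on h unit_ball"
    unfolding h_def by (intro holomorphic_several_on_diff holomorphic_several_on_mult
        holomorphic_several_on_power hp hg hq hf)
  have h_eq: "h z = f z * (Q z - q z)" if "z \<in> unit_ball" for z
  proof (cases "f z = 0")
    case True
    with le[OF that] show ?thesis by (simp add: h_def)
  next
    case False
    then show ?thesis by (simp add: h_def Q_def algebra_simps)
  qed
  have decay: "cmod (hom_part h j z) \<le> (C * D / (1 + real J)) / (1 + real j) ^ m" if z: "z \<in> unit_ball" for j z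
  proof -
    have "hom_part h j z = (\<Sum>i\<le>j. hom_part f i z * hom_part (\<lambda>z. Q z - q z) (j - i) z)"
      by (rule trans[OF hom_part_cong[OF h_eq] hom_part_mult[OF hf holomorphic_several_on_diff[OF hQ hq]]])
    also have "cmod \<dots> \<le> (\<Sum>i\<le>j. C * D / (1 + real J) / (1 + real j) ^ (m + 1))"
    proof (rule sum_norm_le)
      fix i assume i: "i \<in> {..j}"
      have R: "hom_part (\<lambda>z. Q z - q z) (j - i) z = (if j - i < J then 0 else hom_part Q (j - i) z)"
        unfolding q_def by (rule hom_part_taylor_remainder[OF hQ z])
      show "cmod (hom_part f i z * hom_part (\<lambda>z. Q z - q z) (j - i) z)
          \<le> C * D / (1 + real J) / (1 + real j) ^ (m + 1)"
      proof (cases "j - i < J")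
        case True
        then show ?thesis using C(1) D(1) by (simp add: R)
      next
        case False
        have "cmod (hom_part f i z) * cmod (hom_part Q (j - i) z)
            \<le> C * D / (1 + real J) / (1 + real (i + (j - i))) ^ (m + 1)"
          using False by (intro convolution_term_bound norm_ge_zero C(1) D(1) C(2)[OF z] D(2)[OF z]) simp
        then show ?thesis using False i by (simp add: R norm_mult)
      qed
    qed
    also have "\<dots> = (C * D / (1 + real J)) / (1 + real j) ^ m"
    proof -
      have "y * (x / y ^ (m + 1)) = x / y ^ m" if "y \<noteq> 0" for x y :: real
        using that by simp
      from this[of "1 + real j" "C * D / (1 + real J)"] show ?thesis by (simp del: power_Suc)
    qed
    finally show ?thesis .
  qed
  have "C * D / (1 + real J) \<ge> 0" using C(1) D(1) by simp
  from norm_bound[OF hh this decay]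
  have h: "h \<in> dirichlet_space \<alpha>" "dirichlet_norm \<alpha> h \<le> K * (C * D / (1 + real J))" by auto
  have "K * (C * D) < \<epsilon> * (1 + real J)"
    using J \<epsilon> by (simp add: pos_divide_less_eq algebra_simps)
  then have "K * (C * D / (1 + real J)) < \<epsilon>"
    by (simp add: pos_divide_less_eq add_pos_nonneg)
  with h q show ?thesis unfolding h_def by (intro bexI[of _ q]) auto
qed

lemma invariant_subspace_iff:
  fixes h :: "complex ^ 'n::finite \<Rightarrow> complex"
  shows "u \<in> invariant_subspace \<alpha> h \<longleftrightarrow> u \<in> dirichlet_space \<alpha> \<and>
    (\<forall>\<epsilon>>0. \<exists>p\<in>complex_polynomials. (\<lambda>z. p z * h z) \<in> dirichlet_space \<alpha> \<and>
        dirichlet_norm \<alpha> (\<lambda>z. u z - p z * h z) < \<epsilon>)"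
proof -
  have "(\<exists>s \<in> {(\<lambda>z. p z * h z) | p. p \<in> complex_polynomials} \<inter> dirichlet_space \<alpha>. P s) \<longleftrightarrow>
     (\<exists>p\<in>complex_polynomials. (\<lambda>z. p z * h z) \<in> dirichlet_space \<alpha> \<and> P (\<lambda>z. p z * h z))" for P
    by blast
  then show ?thesis
    unfolding invariant_subspace_def span_polynomial_multiples dirichlet_closure_def by simp
qed

theorem theorem3:
  fixes \<alpha> :: real and f g :: "complex ^ 'n::finite \<Rightarrow> complex"
  assumes "f \<in> A_infinity" and "g \<in> A_infinity"
    and "\<And>z. z \<in> unit_ball \<Longrightarrow> cmod (g z) \<le> cmod (f z)"
  shows "\<exists>N::nat. invariant_subspace \<alpha> (\<lambda>z. g z ^ N) \<subseteq> invariant_subspace \<alpha> f"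
proof -
  obtain m K where norm_bound: "\<And>(h :: complex ^ 'n \<Rightarrow> complex) C.
      holomorphic_several_on h unit_ball \<Longrightarrow> C \<ge> 0 \<Longrightarrow>
      (\<And>j z. z \<in> unit_ball \<Longrightarrow> cmod (hom_part h j z) \<le> C / (1 + real j) ^ m) \<Longrightarrow>
      h \<in> dirichlet_space \<alpha> \<and> dirichlet_norm \<alpha> h \<le> K * C"
    using dirichlet_norm_bound_of_decay[of \<alpha>] by blast
  have "invariant_subspace \<alpha> (\<lambda>z. g z ^ (m + 5)) \<subseteq> invariant_subspace \<alpha> f"
  proof
    fix u assume "u \<in> invariant_subspace \<alpha> (\<lambda>z. g z ^ (m + 5))"
    then have u: "u \<in> dirichlet_space \<alpha>" and approx: "\<And>\<epsilon>. \<epsilon> > 0 \<Longrightarrow>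
        \<exists>p\<in>complex_polynomials. (\<lambda>z. p z * g z ^ (m + 5)) \<in> dirichlet_space \<alpha> \<and>
          dirichlet_norm \<alpha> (\<lambda>z. u z - p z * g z ^ (m + 5)) < \<epsilon>"
      by (auto simp: invariant_subspace_iff)
    have "\<exists>q\<in>complex_polynomials. (\<lambda>z. q z * f z) \<in> dirichlet_space \<alpha> \<and>
        dirichlet_norm \<alpha> (\<lambda>z. u z - q z * f z) < \<epsilon>" if \<epsilon>: "\<epsilon> > 0" for \<epsilon>
    proof -
      obtain p where p: "p \<in> complex_polynomials" "(\<lambda>z. p z * g z ^ (m + 5)) \<in> dirichlet_space \<alpha>"
        "dirichlet_norm \<alpha> (\<lambda>z. u z - p z * g z ^ (m + 5)) < \<epsilon> / 2"
        using approx[of "\<epsilon> / 2"] \<epsilon> by auto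
      obtain q where q: "q \<in> complex_polynomials"
        "(\<lambda>z. p z * g z ^ (m + 5) - q z * f z) \<in> dirichlet_space \<alpha>"
        "dirichlet_norm \<alpha> (\<lambda>z. p z * g z ^ (m + 5) - q z * f z) < \<epsilon> / 2"
        using polynomial_multiple_approximation[OF assms(1,2) p(1) assms(3) norm_bound, where \<epsilon> = "\<epsilon> / 2"] \<epsilon> by auto
      have "(\<lambda>z. q z * f z) \<in> dirichlet_space \<alpha>"
        using dirichlet_space_diff[OF p(2) q(2)] by simp
      moreover have "dirichlet_norm \<alpha> (\<lambda>z. u z - q z * f z) < \<epsilon>"
      proof (rule power2_less_imp_less)
        have nn: "dirichlet_norm \<alpha> h \<ge> 0" for h :: "complex ^ 'n \<Rightarrow> complex"
          by (simp add: dirichlet_norm_def infsum_nonneg dirichlet_term_nonneg)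
        have "(dirichlet_norm \<alpha> (\<lambda>z. u z - q z * f z))\<^sup>2
            \<le> 2 * (dirichlet_norm \<alpha> (\<lambda>z. u z - p z * g z ^ (m + 5)))\<^sup>2
              + 2 * (dirichlet_norm \<alpha> (\<lambda>z. p z * g z ^ (m + 5) - q z * f z))\<^sup>2"
          using dirichlet_space_add(2)[OF dirichlet_space_diff[OF u p(2)] q(2)] by simp
        also have "\<dots> < 2 * (\<epsilon> / 2)\<^sup>2 + 2 * (\<epsilon> / 2)\<^sup>2"
          using power_strict_mono[OF p(3) nn, of 2] power_strict_mono[OF q(3) nn, of 2] by simp
        also have "\<dots> = \<epsilon>\<^sup>2" by (simp add: power2_eq_square)
        finally show "(dirichlet_norm \<alpha> (\<lambda>z. u z - q z * f z))\<^sup>2 < \<epsilon>\<^sup>2" .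
      qed (use \<epsilon> in simp)
      ultimately show ?thesis using q(1) by blast
    qed
    with u show "u \<in> invariant_subspace \<alpha> f"
      by (simp add: invariant_subspace_iff)
  qed
  then show ?thesis by blast
qed

end
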